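(* Let $A\in\mathbb{R}^{d\times d}$, $\Sigma\in\mathbb{R}^{d\times r}$ be such that $\Sigma\Sigma^\top$ is (strictly) positive definite, let $(W_t)_{t\ge0}$ be a standard $r$-dimensional Wiener process, let $T>0$, and let $(Z_t)_{t\ge0}$ be the general $d$-dimensional Ornstein-Uhlenbeck process given by $dZ_t=AZ_t\,dt+\Sigma\,dW_t$, $t\ge0$, $Z_0=0$. Then the bridge $(X_t)_{0\le t\le T}$ over $[0,T]$ with endpoints zero derived from $(Z_t)_{t\ge0}$ exists, and its transition densities are $$p^X_{s,t}(x,y)=\sqrt{\frac{\det(\widetilde V_{T-s})}{(2\pi)^d\det(\widetilde V_{t-s}\widetilde V_{T-t})}}\,\exp\Big\{-\tfrac12(x-e^{-(t-s)A}y)^\top\widetilde V_{t-s}^{-1}(x-e^{-(t-s)A}y)-\tfrac12y^\top\widetilde V_{T-t}^{-1}y+\tfrac12x^\top\widetilde V_{T-s}^{-1}x\Big\}$$ for all $x,y\in\mathbb{R}^d$ and all $0\le s<t<T$, where $$\widetilde V_t:=\int_0^t e^{-vA}\,\Sigma\Sigma^\top e^{-vA^\top}\,dv,\qquad t>0.$$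
   Context: The process $Z$ is a time-homogeneous Markov process on $\mathbb{R}^d$ with transition densities with respect to Lebesgue measure $$p^Z_t(x,y)=\frac{1}{\sqrt{(2\pi)^d\det(V_t)}}\exp\left\{-\tfrac12(y-e^{tA}x)^\top V_t^{-1}(y-e^{tA}x)\right\},\quad t>0,\ x,y\in\mathbb{R}^d,$$ where $V_t:=\int_0^t e^{(t-v)A}\,\Sigma\Sigma^\top e^{(t-v)A^\top}\,dv$. For $x,y\in\mathbb{R}^d$ and $0\le s<t<T$ put $$p_{s,t}(x,y):=p^Z_{t-s}(x,y)\lim_{\varepsilon\downarrow0}\frac{\int_{B(0,\varepsilon)}p^Z_{T-t}(y,z)\,dz}{\int_{B(0,\varepsilon)}p^Z_{T-s}(x,z)\,dz}$$ if the right hand side exists and $p_{s,t}(x,y):=0$ otherwise, where $B(0,\varepsilon)$ is the open ball in $\mathbb{R}^d$ with centre $0$ and radius $\varepsilon$. A bridge with endpoints zero over $[0,T]$ derived from $Z$ is a Markov process $(X_t)_{0\le t\le T}$ with $\mathsf{P}(X_0=0)=1$, $\mathsf{P}(X_T=0)=1$ and transition densities $(p_{s,t})_{0\le s<t<T}$ with respect to Lebesgue measure. *)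

theory Defs
  imports "HOL-Probability.Probability"
begin

(* The product of the type real ^ 'n ^ 'n as a vec is componentwise, so powers and the
   exponential have to be built from the matrix product explicitly. *)
definition mat_exp :: "real ^ 'n ^ 'n \<Rightarrow> real ^ 'n ^ 'n" where
  "mat_exp A = (\<Sum>k. (1 / fact k) *\<^sub>R (((**) A ^^ k) (mat 1)))"

definition pos_definite :: "real ^ 'n ^ 'n \<Rightarrow> bool" where
  "pos_definite M \<longleftrightarrow> transpose M = M \<and> (\<forall>x. x \<noteq> 0 \<longrightarrow> x \<bullet> (M *v x) > 0)"

definition past_sigma :: "'w measure \<Rightarrow> real set \<Rightarrow> (real \<Rightarrow> 'w \<Rightarrow> 'a :: topological_space) \<Rightarrow> real \<Rightarrow> 'w measure" where
  "past_sigma M I X s =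
     sigma (space M) {X u -` B \<inter> space M | u B. u \<in> I \<and> u \<le> s \<and> B \<in> sets borel}"

definition markov_process :: "'w measure \<Rightarrow> real set \<Rightarrow> (real \<Rightarrow> 'w \<Rightarrow> 'a :: topological_space) \<Rightarrow> bool" where
  "markov_process M I X \<longleftrightarrow>
     prob_space M \<and>
     (\<forall>t\<in>I. X t \<in> borel_measurable M) \<and>
     (\<forall>s\<in>I. \<forall>t\<in>I. s \<le> t \<longrightarrow> (\<forall>B\<in>sets borel. AE \<omega> in M.
        real_cond_exp M (past_sigma M I X s) (\<lambda>\<omega>. indicator B (X t \<omega>)) \<omega>
        = real_cond_exp M (vimage_algebra (space M) (X s) borel) (\<lambda>\<omega>. indicator B (X t \<omega>)) \<omega>))"

(* Densities of a family of Markov kernels that obeys the Chapman-Kolmogorov equations;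
   the kernels integrate over every set B, so their densities agree up to Lebesgue null sets. *)
definition transition_density_family ::
    "real set \<Rightarrow> (real \<Rightarrow> real \<Rightarrow> 'a \<Rightarrow> 'a :: euclidean_space \<Rightarrow> real) \<Rightarrow> bool" where
  "transition_density_family J p \<longleftrightarrow>
     (\<forall>s\<in>J. \<forall>t\<in>J. s < t \<longrightarrow>
        (\<lambda>(x, y). p s t x y) \<in> borel_measurable (borel \<Otimes>\<^sub>M borel) \<and>
        (\<forall>x y. p s t x y \<ge> 0) \<and>
        (\<forall>x. (\<integral>\<^sup>+y. ennreal (p s t x y) \<partial>lborel) = 1)) \<and>
     (\<forall>s\<in>J. \<forall>t\<in>J. \<forall>u\<in>J. s < t \<longrightarrow> t < u \<longrightarrow> (\<forall>x. AE z in lborel.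
        ennreal (p s u x z) = (\<integral>\<^sup>+y. ennreal (p s t x y * p t u y z) \<partial>lborel)))"

definition has_transition_densities ::
    "'w measure \<Rightarrow> real set \<Rightarrow> (real \<Rightarrow> 'w \<Rightarrow> 'a) \<Rightarrow> (real \<Rightarrow> real \<Rightarrow> 'a \<Rightarrow> 'a :: euclidean_space \<Rightarrow> real) \<Rightarrow> bool" where
  "has_transition_densities M J X p \<longleftrightarrow>
     transition_density_family J p \<and>
     (\<forall>s\<in>J. \<forall>t\<in>J. s < t \<longrightarrow> (\<forall>B\<in>sets borel. AE \<omega> in M.
        real_cond_exp M (vimage_algebra (space M) (X s) borel) (\<lambda>\<omega>. indicator B (X t \<omega>)) \<omega>
        = (LINT y:B|lborel. p s t (X s \<omega>) y)))"

(* p t x y are the transition densities of a time-homogeneous process. *)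
definition bridge_density ::
    "(real \<Rightarrow> 'a \<Rightarrow> 'a :: euclidean_space \<Rightarrow> real) \<Rightarrow> real \<Rightarrow> real \<Rightarrow> real \<Rightarrow> 'a \<Rightarrow> 'a \<Rightarrow> real" where
  "bridge_density p T s t x y =
     (let R = (\<lambda>\<epsilon>. (LINT z:ball 0 \<epsilon>|lborel. p (T - t) y z) / (LINT z:ball 0 \<epsilon>|lborel. p (T - s) x z))
      in if \<exists>l. (R \<longlongrightarrow> l) (at_right 0) then p (t - s) x y * Lim (at_right 0) R else 0)"

definition zero_bridge ::
    "(real \<Rightarrow> 'a \<Rightarrow> 'a :: euclidean_space \<Rightarrow> real) \<Rightarrow> real \<Rightarrow> 'w measure \<Rightarrow> (real \<Rightarrow> 'w \<Rightarrow> 'a) \<Rightarrow> bool" where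
  "zero_bridge p T M X \<longleftrightarrow>
     markov_process M {0..T} X \<and>
     (AE \<omega> in M. X 0 \<omega> = 0) \<and>
     (AE \<omega> in M. X T \<omega> = 0) \<and>
     has_transition_densities M {0..<T} X (bridge_density p T)"

definition wiener_process :: "'w measure \<Rightarrow> (real \<Rightarrow> 'w \<Rightarrow> real ^ 'r) \<Rightarrow> bool" where
  "wiener_process M W \<longleftrightarrow>
     prob_space M \<and>
     (\<forall>t\<ge>0. W t \<in> borel_measurable M) \<and>
     (AE \<omega> in M. W 0 \<omega> = 0) \<and>
     (AE \<omega> in M. continuous_on {0..} (\<lambda>t. W t \<omega>)) \<and>
     (\<forall>s t. 0 \<le> s \<longrightarrow> s < t \<longrightarrow>
        distributed M lborel (\<lambda>\<omega>. W t \<omega> - W s \<omega>)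
          (\<lambda>x. ennreal (\<Prod>i\<in>UNIV. normal_density 0 (sqrt (t - s)) (x $ i))) \<and>
        prob_space.indep_set M (sets (past_sigma M {0..} W s))
          (sets (vimage_algebra (space M) (\<lambda>\<omega>. W t \<omega> - W s \<omega>) borel)))"

(* dZ = A Z dt + S dW with Z 0 = 0. As the noise is additive with constant S, its stochastic
   integral over [0,t] is S (W t - W 0), and the integral form of the equation is pathwise. *)
definition ou_process ::
    "real ^ 'd ^ 'd \<Rightarrow> real ^ 'r ^ 'd \<Rightarrow> 'w measure \<Rightarrow> (real \<Rightarrow> 'w \<Rightarrow> real ^ 'r) \<Rightarrow> (real \<Rightarrow> 'w \<Rightarrow> real ^ 'd) \<Rightarrow> bool" where
  "ou_process A S M W Z \<longleftrightarrow>
     (\<forall>t\<ge>0. Z t \<in> borel_measurable M) \<and>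
     (AE \<omega> in M. Z 0 \<omega> = 0 \<and> continuous_on {0..} (\<lambda>t. Z t \<omega>) \<and>
        (\<forall>t\<ge>0. Z t \<omega> = integral {0..t} (\<lambda>v. A *v Z v \<omega>) + S *v (W t \<omega> - W 0 \<omega>)))"

definition ou_cov :: "real ^ 'd ^ 'd \<Rightarrow> real ^ 'r ^ 'd \<Rightarrow> real \<Rightarrow> real ^ 'd ^ 'd" where
  "ou_cov A S t = integral {0..t} (\<lambda>v.
     mat_exp ((t - v) *\<^sub>R A) ** (S ** transpose S) ** mat_exp ((t - v) *\<^sub>R transpose A))"

definition ou_density :: "real ^ 'd ^ 'd \<Rightarrow> real ^ 'r ^ 'd \<Rightarrow> real \<Rightarrow> real ^ 'd \<Rightarrow> real ^ 'd \<Rightarrow> real" where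
  "ou_density A S t x y =
     1 / sqrt ((2 * pi) ^ CARD('d) * det (ou_cov A S t)) *
     exp (- (1 / 2) * ((y - mat_exp (t *\<^sub>R A) *v x) \<bullet>
       (matrix_inv (ou_cov A S t) *v (y - mat_exp (t *\<^sub>R A) *v x))))"

definition ou_cov_tilde :: "real ^ 'd ^ 'd \<Rightarrow> real ^ 'r ^ 'd \<Rightarrow> real \<Rightarrow> real ^ 'd ^ 'd" where
  "ou_cov_tilde A S t = integral {0..t} (\<lambda>v.
     mat_exp (- v *\<^sub>R A) ** (S ** transpose S) ** mat_exp (- v *\<^sub>R transpose A))"

end

theory Submission
  imports Defs
begin

text \<open>
Write \<open>p t x y\<close> for the Gaussian transition density of the Ornstein-Uhlenbeck process, \<open>V t\<close> for its
covariance and \<open>E t\<close> for the exponential of \<open>t A\<close>.  As \<open>p t x\<close> is continuous and positive, the quotient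
of the integrals over a shrinking ball around \<open>0\<close> converges to the quotient of the values at \<open>0\<close>
(\<open>ball_ratio_tendsto\<close>), so that the bridge density is Doob's transform
\<open>p (t - s) x y * h t y / h s x\<close> with \<open>h t y = p (T - t) y 0\<close> (\<open>bridge_density_eq\<close>).

The second half of the theorem is then an algebraic identity.  The covariance of the time-reversed
flow, \<open>V' t\<close>, satisfies \<open>V t = E t V' t (E t)\<^sup>T\<close> (\<open>ou_cov_eq_tilde\<close>); hence the quadratic form of
\<open>(V t)\<^sup>-\<^sup>1\<close> at \<open>y - E t x\<close> is that of \<open>(V' t)\<^sup>-\<^sup>1\<close> at \<open>x - E (- t) y\<close>, and the squared determinants of the
three exponentials cancel because \<open>E (T - s) = E (t - s) E (T - t)\<close> (\<open>bridge_density_tilde\<close>).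

For existence, the Chapman-Kolmogorov equation of \<open>p\<close> says that \<open>h\<close> is space-time harmonic; so the
bridge densities have total mass one, and they inherit the Chapman-Kolmogorov equation
(\<open>markov_densities_bridge\<close>).  Kolmogorov's extension theorem turns such a family into a measure on
the paths over the open interval from \<open>0\<close> to \<open>T\<close>, and the process is completed by the value \<open>0\<close> at all
other times.  Its Markov property is checked on cylinder sets (\<open>nn_integral_transition\<close>) and carried
over to the whole past by uniqueness of measures on product spaces.

The equation for \<open>p\<close> itself follows from \<open>V (s + t) = V t + E t V s (E t)\<^sup>T\<close> (\<open>ou_cov_add\<close>) and a
convolution formula for Gaussian densities (\<open>gauss_density_convolution\<close>), which is proved by
completing the square.  The normalising constant is found there by comparing total masses, so that no
identity between determinants is needed; only the Gaussian integral itself requires one, and with it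
the transformation of Lebesgue measure under invertible matrices (\<open>nn_integral_lborel_matrix\<close>).
\<close>

section \<open>Linear changes of variables in Lebesgue integrals\<close>

lemma prod_Basis_vec:
  fixes g :: "real ^ 'n \<Rightarrow> 'b :: comm_monoid_mult"
  shows "(\<Prod>b\<in>Basis. g b) = (\<Prod>i\<in>UNIV. g (axis i 1))"
proof -
  have "Basis = range (\<lambda>i::'n. axis i (1::real))"
    by (auto simp: Basis_vec_def)
  moreover have "inj (\<lambda>i::'n. axis i (1::real))"
    by (simp add: inj_on_def axis_eq_axis)
  ultimately show ?thesis
    using prod.reindex[of "\<lambda>i::'n. axis i (1::real)" UNIV g] by (simp add: o_def)
qed

lemma borel_measurable_matrix_vector_mult [measurable]:
  fixes A :: "real ^ 'n ^ 'm"
  shows "(*v) A \<in> borel_measurable borel"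
  by (intro borel_measurable_continuous_onI linear_continuous_on matrix_vector_mul_bounded_linear)

lemma nn_integral_lborel_diagonal:
  fixes A :: "real ^ 'n ^ 'n"
  assumes diag: "\<And>i j. i \<noteq> j \<Longrightarrow> A $ i $ j = 0" and "det A \<noteq> 0"
    and [measurable]: "f \<in> borel_measurable borel"
  shows "(\<integral>\<^sup>+x. f x \<partial>lborel) = ennreal \<bar>det A\<bar> * (\<integral>\<^sup>+x. f (A *v x) \<partial>lborel)"
proof -
  define c where "c j = j \<bullet> (A *v j)" for j :: "real ^ 'n"
  have comp: "(A *v x) $ i = A $ i $ i * x $ i" for x i
  proof -
    have "(\<Sum>j\<in>UNIV. A $ i $ j * x $ j) = (\<Sum>j\<in>UNIV. if j = i then A $ i $ i * x $ i else 0)"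
      by (rule sum.cong) (auto simp: diag)
    then show ?thesis by (simp add: matrix_vector_mult_def)
  qed
  have c: "c (axis i 1) = A $ i $ i" for i
    by (simp add: c_def inner_axis' comp)
  have det: "det A = (\<Prod>i\<in>UNIV. A $ i $ i)"
    using det_diagonal[of A] diag by auto
  have T: "A *v x = 0 + (\<Sum>j\<in>Basis. (c j * (x \<bullet> j)) *\<^sub>R j)" for x
  proof (rule euclidean_eqI)
    fix b :: "real ^ 'n" assume "b \<in> Basis"
    then have "(0 + (\<Sum>j\<in>Basis. (c j * (x \<bullet> j)) *\<^sub>R j)) \<bullet> b = c b * (x \<bullet> b)"
      by simp
    moreover from \<open>b \<in> Basis\<close> obtain i where "b = axis i 1" by (auto simp: Basis_vec_def)
    ultimately show "(A *v x) \<bullet> b = (0 + (\<Sum>j\<in>Basis. (c j * (x \<bullet> j)) *\<^sub>R j)) \<bullet> b"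
      by (simp add: inner_axis comp c)
  qed
  have "c j \<noteq> 0" if "j \<in> Basis" for j
    using that assms(2) det c by (auto simp: Basis_vec_def)
  then have "lborel = density (distr lborel borel (\<lambda>x. A *v x)) (\<lambda>_. (\<Prod>j\<in>Basis. \<bar>c j\<bar>))"
    unfolding T by (rule lborel_affine_euclidean)
  also have "(\<Prod>j\<in>Basis. \<bar>c j\<bar>) = \<bar>det A\<bar>"
    by (simp add: prod_Basis_vec c det abs_prod)
  finally have eq: "lborel = density (distr lborel borel (\<lambda>x. A *v x)) (\<lambda>_. ennreal \<bar>det A\<bar>)" .
  show ?thesis
    by (subst eq) (simp add: nn_integral_density nn_integral_distr nn_integral_cmult)
qed

lemma nn_integral_lborel_swap:
  fixes f :: "real ^ 'n \<Rightarrow> ennreal"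
  assumes [measurable]: "f \<in> borel_measurable borel"
  shows "(\<integral>\<^sup>+x. f x \<partial>lborel) = (\<integral>\<^sup>+x. f (\<chi> i. x $ Transposition.transpose m n i) \<partial>lborel)"
proof -
  let ?h = "\<lambda>x::real^'n. \<chi> i. x $ Transposition.transpose m n i"
  have "linear ?h"
    by (rule linearI) (simp_all add: vec_eq_iff)
  then have [measurable]: "?h \<in> borel_measurable borel"
    by (intro borel_measurable_continuous_onI linear_continuous_on) (simp add: linear_conv_bounded_linear)
  have "lborel = distr lborel borel ?h"
  proof (rule lborel_eqI)
    fix l u :: "real ^ 'n" assume le: "\<And>b. b \<in> Basis \<Longrightarrow> l \<bullet> b \<le> u \<bullet> b"
    then have le': "l $ i \<le> u $ i" for i
      using le[of "axis i 1"] by (simp add: inner_axis)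
    have "?h -` box l u = box (?h l) (?h u)"
      by (auto simp: mem_box_cart) (metis transpose_involutory)+
    then have "emeasure (distr lborel borel ?h) (box l u) = emeasure lborel (box (?h l) (?h u))"
      by (simp add: emeasure_distr)
    also have "\<dots> = (\<Prod>b\<in>Basis. (?h u - ?h l) \<bullet> b)"
      by (rule emeasure_lborel_box) (auto simp: Basis_vec_def inner_axis le')
    also have "(\<Prod>b\<in>Basis. (?h u - ?h l) \<bullet> b) = (\<Prod>b\<in>Basis. (u - l) \<bullet> b)"
      using prod.permute [OF permutes_swap_id[of m UNIV n], of "\<lambda>i. (u - l)$i"]
      by (simp add: prod_Basis_vec inner_axis o_def)
    finally show "emeasure (distr lborel borel ?h) (box l u) = (\<Prod>b\<in>Basis. (u - l) \<bullet> b)" .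
  qed simp
  then have "(\<integral>\<^sup>+x. f x \<partial>lborel) = (\<integral>\<^sup>+x. f x \<partial>distr lborel borel ?h)"
    by simp
  then show ?thesis
    by (simp add: nn_integral_distr)
qed

text \<open>
Fubini's theorem in the coordinate along \<open>b\<close>: for fixed other coordinates, a shear is a translation of
that coordinate.
\<close>
lemma nn_integral_lborel_shear:
  fixes f :: "'a::euclidean_space \<Rightarrow> ennreal"
  assumes [measurable]: "f \<in> borel_measurable borel"
    and b: "b \<in> Basis" "b' \<in> Basis" "b \<noteq> b'"
  shows "(\<integral>\<^sup>+x. f x \<partial>lborel) = (\<integral>\<^sup>+x. f (x + (c * (x \<bullet> b')) *\<^sub>R b) \<partial>lborel)"
proof -
  interpret product_sigma_finite "\<lambda>_. lborel :: real measure" ..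
  define K where "K = (Basis :: 'a set) - {b}"
  have K: "finite K" "b \<notin> K" "Basis = insert b K" "b' \<in> K"
    using b by (auto simp: K_def)
  define \<Phi> where "\<Phi> w = (\<Sum>a\<in>Basis. w a *\<^sub>R a)" for w :: "'a \<Rightarrow> real"
  have lb: "lborel = distr (\<Pi>\<^sub>M b\<in>Basis. lborel) borel \<Phi>"
    unfolding \<Phi>_def by (rule lborel_eq)
  have [measurable]: "\<Phi> \<in> borel_measurable (\<Pi>\<^sub>M b\<in>Basis. lborel)"
    unfolding \<Phi>_def by measurable
  have [measurable]: "\<Phi> \<in> borel_measurable (\<Pi>\<^sub>M b\<in>insert b K. lborel)"
    unfolding K(3)[symmetric] by measurable
  have upd: "\<Phi> (w(b := y)) = y *\<^sub>R b + (\<Sum>a\<in>K. w a *\<^sub>R a)" for w y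
    unfolding \<Phi>_def K(3) using K(1,2) by (auto intro!: sum.cong)
  have inb: "\<Phi> (w(b := y)) \<bullet> b' = w b'" for w y
    using b by (simp add: \<Phi>_def)
  have shift: "\<Phi> (w(b := y)) + (c * (\<Phi> (w(b := y)) \<bullet> b')) *\<^sub>R b = \<Phi> (w(b := c * w b' + 1 * y))" for w y
    unfolding inb unfolding upd by (simp add: algebra_simps)
  have tr: "(\<integral>\<^sup>+y. g (t + 1 * y) \<partial>lborel) = (\<integral>\<^sup>+y. g y \<partial>lborel)" if [measurable]: "g \<in> borel_measurable borel" for g :: "real \<Rightarrow> ennreal" and t
    using nn_integral_real_affine[of g 1 t] by simp
  have "(\<integral>\<^sup>+x. f (x + (c * (x \<bullet> b')) *\<^sub>R b) \<partial>lborel)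
      = (\<integral>\<^sup>+w. f (\<Phi> w + (c * (\<Phi> w \<bullet> b')) *\<^sub>R b) \<partial>(\<Pi>\<^sub>M b\<in>insert b K. lborel))"
    by (subst lb, subst nn_integral_distr) (simp_all add: K(3)[symmetric])
  also have "\<dots> = (\<integral>\<^sup>+w. \<integral>\<^sup>+y. f (\<Phi> (w(b := c * w b' + 1 * y))) \<partial>lborel \<partial>(\<Pi>\<^sub>M b\<in>K. lborel))"
    using K by (subst product_nn_integral_insert) (simp_all only: shift, measurable)
  also have "\<dots> = (\<integral>\<^sup>+w. \<integral>\<^sup>+y. f (\<Phi> (w(b := y))) \<partial>lborel \<partial>(\<Pi>\<^sub>M b\<in>K. lborel))"
    unfolding upd by (intro nn_integral_cong tr) measurable
  also have "\<dots> = (\<integral>\<^sup>+w. f (\<Phi> w) \<partial>(\<Pi>\<^sub>M b\<in>insert b K. lborel))"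
    using K by (subst product_nn_integral_insert) (simp_all, measurable)
  also have "\<dots> = (\<integral>\<^sup>+x. f x \<partial>lborel)"
    by (subst lb, subst nn_integral_distr) (simp_all add: K(3)[symmetric])
  finally show ?thesis ..
qed

text \<open>
Every matrix is a product of diagonal matrices, transpositions, shears and matrices with a zero row;
the last kind is excluded by the determinant.  Working with elementary matrices keeps the index type
free of any ordering.
\<close>
lemma nn_integral_lborel_matrix:
  fixes A :: "real ^ 'n ^ 'n"
  assumes "det A \<noteq> 0" "f \<in> borel_measurable borel"
  shows "(\<integral>\<^sup>+x. f x \<partial>lborel) = ennreal \<bar>det A\<bar> * (\<integral>\<^sup>+x. f (A *v x) \<partial>lborel)"
proof -
  let ?P = "\<lambda>A::real^'n^'n. \<forall>f \<in> borel_measurable borel. det A \<noteq> 0 \<longrightarrow>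
    (\<integral>\<^sup>+x. f x \<partial>lborel) = ennreal \<bar>det A\<bar> * (\<integral>\<^sup>+x. f (A *v x) \<partial>lborel)"
  have "?P A"
  proof (rule induct_matrix_elementary[where P = ?P], goal_cases)
    case (1 A B)
    show ?case
    proof (intro ballI impI)
      fix f :: "real ^ 'n \<Rightarrow> ennreal"
      assume f [measurable]: "f \<in> borel_measurable borel" and "det (A ** B) \<noteq> 0"
      then have "det A \<noteq> 0" "det B \<noteq> 0" by (auto simp: det_mul)
      have "(\<integral>\<^sup>+x. f x \<partial>lborel) = ennreal \<bar>det A\<bar> * (\<integral>\<^sup>+x. f (A *v x) \<partial>lborel)"
        using 1 f \<open>det A \<noteq> 0\<close> by blast
      also have "(\<integral>\<^sup>+x. f (A *v x) \<partial>lborel) = ennreal \<bar>det B\<bar> * (\<integral>\<^sup>+x. f (A *v (B *v x)) \<partial>lborel)"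
        using 1(2)[rule_format, of "\<lambda>x. f (A *v x)"] \<open>det B \<noteq> 0\<close> by simp
      finally show "(\<integral>\<^sup>+x. f x \<partial>lborel) = ennreal \<bar>det (A ** B)\<bar> * (\<integral>\<^sup>+x. f ((A ** B) *v x) \<partial>lborel)"
        by (simp add: det_mul abs_mult ennreal_mult matrix_vector_mul_assoc mult.assoc)
    qed
  next
    case (2 A i)
    then show ?case by (simp add: det_zero_row)
  next
    case (3 A)
    then show ?case using nn_integral_lborel_diagonal by blast
  next
    case (4 m n)
    let ?S = "(\<chi> i j. mat 1 $ i $ Transposition.transpose m n j) :: real^'n^'n"
    have "\<bar>det ?S\<bar> = 1"
      by (simp add: det_permute_columns permutes_swap_id sign_swap_id abs_mult)
    moreover have "?S *v x = (\<chi> i. x $ Transposition.transpose m n i)" for x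
    proof -
      have "(\<Sum>j\<in>UNIV. mat 1 $ i $ Transposition.transpose m n j * x $ j)
         = (\<Sum>j\<in>UNIV. if j = Transposition.transpose m n i then x $ j else 0)" for i
        by (intro sum.cong) (auto simp: mat_def)
      then show ?thesis
        by (simp add: vec_eq_iff matrix_vector_mult_def)
    qed
    ultimately show ?case
      using nn_integral_lborel_swap[of _ m n] by (intro ballI impI) (simp only: ennreal_1 mult_1)
  next
    case (5 m n c)
    let ?S = "(\<chi> i j. if i = m \<and> j = n then c else of_bool (i = j)) :: real^'n^'n"
    have "?S = (\<chi> k. if k = m then row m (mat 1) + c *s row n (mat 1) else row k (mat 1))"
      using 5 by (auto simp: vec_eq_iff row_def mat_def)
    then have "det ?S = 1"
      using det_row_operation[OF 5, of "mat 1" c] by (simp add: det_I)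
    moreover have "?S *v x = x + (c * (x \<bullet> axis n 1)) *\<^sub>R axis m 1" for x
    proof -
      have "(\<Sum>j\<in>UNIV. (if i = m \<and> j = n then c else of_bool (i = j)) * x $ j)
         = (\<Sum>j\<in>UNIV. (if j = i then x $ j else 0) + (if j = n then (if i = m then c * x $ n else 0) else 0))" for i
        using 5 by (intro sum.cong) auto
      then show ?thesis
        by (simp add: vec_eq_iff matrix_vector_mult_def sum.distrib inner_axis) (simp add: axis_def)
    qed
    moreover have "(\<integral>\<^sup>+x. f x \<partial>lborel) = (\<integral>\<^sup>+x. f (x + (c * (x \<bullet> axis n 1)) *\<^sub>R axis m 1) \<partial>lborel)"
      if "f \<in> borel_measurable borel" for f :: "real ^ 'n \<Rightarrow> ennreal"
      using that 5 by (intro nn_integral_lborel_shear) (auto simp: axis_eq_axis)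
    ultimately show ?case
      by (intro ballI impI) (simp only: abs_one ennreal_1 mult_1)
  qed
  with assms show ?thesis by blast
qed

section \<open>Positive definite matrices and Gaussian densities\<close>

lemma matrix_inv_mult:
  fixes A :: "'a::field ^ 'n ^ 'n"
  assumes "invertible A"
  shows "A ** matrix_inv A = mat 1" "matrix_inv A ** A = mat 1"
proof -
  have "A ** matrix_inv A = mat 1 \<and> matrix_inv A ** A = mat 1"
    using assms unfolding invertible_def matrix_inv_def by (rule someI_ex)
  then show "A ** matrix_inv A = mat 1" "matrix_inv A ** A = mat 1"
    by auto
qed

lemma matrix_inv_unique:
  fixes A :: "'a::field ^ 'n ^ 'n"
  assumes "A ** B = mat 1"
  shows "matrix_inv A = B"
proof -
  have "invertible A"
    using assms invertible_right_inverse by blast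
  have "matrix_inv A = matrix_inv A ** (A ** B)"
    by (simp add: assms)
  also have "\<dots> = (matrix_inv A ** A) ** B"
    by (rule matrix_mul_assoc)
  also have "\<dots> = B"
    by (simp add: matrix_inv_mult[OF \<open>invertible A\<close>])
  finally show ?thesis .
qed

lemma matrix_inv_mult_vec:
  fixes A :: "'a::field ^ 'n ^ 'n"
  assumes "invertible A"
  shows "A *v (matrix_inv A *v x) = x" "matrix_inv A *v (A *v x) = x"
  using matrix_inv_mult[OF assms] by (simp_all add: matrix_vector_mul_assoc)

lemma det_matrix_inv:
  fixes A :: "'a::field ^ 'n ^ 'n"
  assumes "invertible A"
  shows "det A * det (matrix_inv A) = 1"
  using matrix_inv_mult(1)[OF assms] by (metis det_I det_mul)

lemma inner_matrix_vector_swap: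
  fixes A :: "real ^ 'n ^ 'm"
  shows "x \<bullet> (A *v y) = (transpose A *v x) \<bullet> y"
  by (simp add: dot_lmul_matrix)

lemma pos_definite_inner_commute:
  "pos_definite M \<Longrightarrow> x \<bullet> (M *v y) = (M *v x) \<bullet> y"
  by (metis inner_matrix_vector_swap pos_definite_def)

lemma pos_definite_invertible:
  assumes "pos_definite M"
  shows "invertible M"
proof -
  have "\<forall>x. M *v x = 0 \<longrightarrow> x = 0"
    using assms by (force simp: pos_definite_def)
  then show ?thesis
    by (simp add: invertible_left_inverse matrix_left_invertible_ker)
qed

lemma pos_definite_matrix_inv:
  assumes "pos_definite M"
  shows "pos_definite (matrix_inv M)"
  unfolding pos_definite_def
proof (intro conjI allI impI)
  note inv = pos_definite_invertible[OF assms]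
  have "M ** transpose (matrix_inv M) = transpose (matrix_inv M ** M)"
    using assms by (simp add: matrix_transpose_mul pos_definite_def)
  then have "M ** transpose (matrix_inv M) = mat 1"
    by (simp add: matrix_inv_mult[OF inv] transpose_mat)
  then show "transpose (matrix_inv M) = matrix_inv M"
    by (metis matrix_inv_unique)
  fix x :: "real ^ 'a" assume "x \<noteq> 0"
  define y where "y = matrix_inv M *v x"
  have x: "x = M *v y"
    by (simp add: y_def matrix_inv_mult_vec[OF inv])
  with \<open>x \<noteq> 0\<close> have "y \<noteq> 0" by auto
  then have "0 < y \<bullet> (M *v y)"
    using assms by (simp add: pos_definite_def)
  then show "0 < x \<bullet> (matrix_inv M *v x)"
    by (simp add: y_def[symmetric] x[symmetric] inner_commute)
qed

text \<open>
The columns of \<open>B\<close> form an orthonormal basis for the inner product defined by \<open>M\<close>.  They can be chosen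
one after the other: as long as fewer than \<open>n\<close> vectors \<open>b i\<close> are given, the vectors \<open>M b i\<close> do not span
the whole space, and a nonzero vector orthogonal to their span can be normalised and added.
\<close>
lemma pos_definite_orthonormalize:
  fixes M :: "real ^ 'n ^ 'n"
  assumes M: "pos_definite M"
  obtains B :: "real ^ 'n ^ 'n" where "transpose B ** M ** B = mat 1"
proof -
  have "\<exists>b :: 'n \<Rightarrow> real ^ 'n. \<forall>i\<in>S. \<forall>j\<in>S. b i \<bullet> (M *v b j) = (if i = j then 1 else 0)"
    if "finite S" for S :: "'n set"
    using that
  proof (induction S)
    case (insert k S)
    then obtain b where b: "\<And>i j. i \<in> S \<Longrightarrow> j \<in> S \<Longrightarrow> b i \<bullet> (M *v b j) = (if i = j then 1 else 0)"
      by blast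
    have "dim ((\<lambda>i. M *v b i) ` S) \<le> card ((\<lambda>i. M *v b i) ` S)"
      using insert.hyps by (intro dim_le_card') auto
    also have "\<dots> \<le> card S"
      using insert.hyps by (intro card_image_le) auto
    also have "\<dots> < CARD('n)"
      using insert.hyps by (intro psubset_card_mono) auto
    finally have "dim ((\<lambda>i. M *v b i) ` S) < DIM(real ^ 'n)" by simp
    then obtain v where v: "v \<noteq> 0" "\<And>y. y \<in> span ((\<lambda>i. M *v b i) ` S) \<Longrightarrow> orthogonal v y"
      using orthogonal_to_subspace_exists by blast
    have vb: "v \<bullet> (M *v b i) = 0" if "i \<in> S" for i
      using v(2)[of "M *v b i"] that by (auto simp: span_base orthogonal_def)
    then have bv: "b i \<bullet> (M *v v) = 0" if "i \<in> S" for i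
      using vb[OF that] pos_definite_inner_commute[OF M, of "b i" v] by (simp add: inner_commute)
    define c where "c = v \<bullet> (M *v v)"
    have "c > 0"
      using M v(1) by (simp add: c_def pos_definite_def)
    define b' where "b' = b(k := (1 / sqrt c) *\<^sub>R v)"
    have k: "b' i = b i" if "i \<in> S" for i
      using that insert.hyps by (auto simp: b'_def)
    have "b' k \<bullet> (M *v b' k) = 1"
      using \<open>c > 0\<close> by (simp add: b'_def matrix_vector_mult_scaleR c_def[symmetric])
    moreover have "b' k \<bullet> (M *v b' i) = 0" "b' i \<bullet> (M *v b' k) = 0" if "i \<in> S" for i
      using that k[OF that] vb bv by (simp_all add: b'_def matrix_vector_mult_scaleR)
    ultimately have "\<forall>i\<in>insert k S. \<forall>j\<in>insert k S. b' i \<bullet> (M *v b' j) = (if i = j then 1 else 0)"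
      using b k insert.hyps by auto
    then show ?case by blast
  qed simp
  from this[of UNIV] obtain b :: "'n \<Rightarrow> real ^ 'n"
    where b: "\<And>i j. b i \<bullet> (M *v b j) = (if i = j then 1 else 0)" by auto
  define B :: "real ^ 'n ^ 'n" where "B = (\<chi> i j. b j $ i)"
  have col: "B *v axis j 1 = b j" for j
    by (simp add: B_def vec_eq_iff column_def matrix_vector_mult_basis)
  have "(transpose B ** M ** B) $ i $ j = axis i 1 \<bullet> ((transpose B ** M ** B) *v axis j 1)" for i j
    by (simp add: matrix_vector_mult_basis column_def inner_axis')
  also have "axis i 1 \<bullet> ((transpose B ** M ** B) *v axis j 1) = (B *v axis i 1) \<bullet> (M *v (B *v axis j 1))" for i j
    by (metis inner_matrix_vector_swap matrix_vector_mul_assoc transpose_transpose)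
  finally have "transpose B ** M ** B = mat 1"
    by (simp add: vec_eq_iff mat_def col b)
  with that show ?thesis .
qed

lemma pos_definite_det_pos:
  fixes M :: "real ^ 'n ^ 'n"
  assumes "pos_definite M"
  shows "det M > 0"
proof -
  from pos_definite_orthonormalize[OF assms] obtain B :: "real ^ 'n ^ 'n" where B: "transpose B ** M ** B = mat 1" .
  then have "det (transpose B ** M ** B) = 1" by simp
  then have "0 < (det B)\<^sup>2 * det M"
    by (simp add: det_mul power2_eq_square mult_ac)
  then show ?thesis
    by (simp add: zero_less_mult_iff)
qed

lemma pos_definite_congruence:
  fixes E :: "real ^ 'n ^ 'n"
  assumes "pos_definite V" "invertible E"
  shows "pos_definite (E ** V ** transpose E)"
  unfolding pos_definite_def
proof (intro conjI allI impI)
  show "transpose (E ** V ** transpose E) = E ** V ** transpose E"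
    using assms(1) by (simp add: matrix_transpose_mul matrix_mul_assoc pos_definite_def)
  fix x :: "real ^ 'n" assume "x \<noteq> 0"
  have "invertible (transpose E)"
    using assms(2) by (simp add: invertible_det_nz)
  then have "transpose E *v x \<noteq> 0"
    using \<open>x \<noteq> 0\<close> by (metis matrix_inv_mult_vec(2) matrix_vector_mult_0_right)
  then have "0 < (transpose E *v x) \<bullet> (V *v (transpose E *v x))"
    using assms(1) unfolding pos_definite_def by blast
  then show "0 < x \<bullet> ((E ** V ** transpose E) *v x)"
    by (metis inner_matrix_vector_swap matrix_vector_mul_assoc)
qed

definition gauss_density :: "real ^ 'n ^ 'n \<Rightarrow> real ^ 'n \<Rightarrow> real" where
  "gauss_density V z =
     1 / sqrt ((2 * pi) ^ CARD('n) * det V) * exp (- (1 / 2) * (z \<bullet> (matrix_inv V *v z)))"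

lemma gauss_density_pos: "pos_definite V \<Longrightarrow> gauss_density V z > 0"
  unfolding gauss_density_def by (intro mult_pos_pos) (simp_all add: pos_definite_det_pos)

lemma continuous_on_gauss_density [continuous_intros]:
  fixes f :: "'a::topological_space \<Rightarrow> real ^ 'n"
  assumes "continuous_on S f"
  shows "continuous_on S (\<lambda>x. gauss_density V (f x))"
  unfolding gauss_density_def
  by (intro continuous_intros assms bounded_linear.continuous_on[OF matrix_vector_mul_bounded_linear])

lemma borel_measurable_gauss_density [measurable]: "gauss_density V \<in> borel_measurable borel"
  by (intro borel_measurable_continuous_onI continuous_on_gauss_density continuous_on_id)

lemma nn_integral_exp_norm_square:
  "(\<integral>\<^sup>+x. ennreal (exp (- (1 / 2) * (x \<bullet> x))) \<partial>(lborel :: 'a::euclidean_space measure))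
     = ennreal (sqrt (2 * pi) ^ DIM('a))"
proof -
  have one: "(\<integral>\<^sup>+x. ennreal (exp (- x\<^sup>2 / 2)) \<partial>lborel) = ennreal (sqrt (2 * pi))"
  proof -
    have "(\<integral>\<^sup>+x. ennreal (exp (- x\<^sup>2 / 2)) \<partial>lborel)
        = (\<integral>\<^sup>+x. ennreal (sqrt (2 * pi)) * ennreal (std_normal_density x) \<partial>lborel)"
      by (simp add: std_normal_density_def flip: ennreal_mult)
    also have "\<dots> = ennreal (sqrt (2 * pi)) * ennreal (\<integral>x. std_normal_density x \<partial>lborel)"
      by (subst nn_integral_cmult) (simp_all add: nn_integral_eq_integral)
    finally show ?thesis by simp
  qed
  have "exp (- (1 / 2) * (x \<bullet> x)) = (\<Prod>b\<in>Basis. exp (- (x \<bullet> b)\<^sup>2 / 2))" for x :: 'a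
    by (subst euclidean_inner[of x x])
      (simp add: exp_sum[symmetric] sum_divide_distrib sum_negf power2_eq_square)
  then have "(\<integral>\<^sup>+x. ennreal (exp (- (1 / 2) * (x \<bullet> x))) \<partial>(lborel :: 'a measure))
     = (\<integral>\<^sup>+x. (\<Prod>b\<in>Basis. ennreal (exp (- (x \<bullet> b)\<^sup>2 / 2))) \<partial>(lborel :: 'a measure))"
    by (simp add: prod_ennreal)
  also have "\<dots> = (\<Prod>b\<in>(Basis :: 'a set). \<integral>\<^sup>+x. ennreal (exp (- x\<^sup>2 / 2)) \<partial>lborel)"
    by (rule nn_integral_lborel_prod) auto
  also have "\<dots> = ennreal (sqrt (2 * pi) ^ DIM('a))"
    by (simp add: one[simplified] ennreal_power)
  finally show ?thesis .
qed

text \<open>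
In coordinates that are orthonormal for the inverse of \<open>V\<close>, the exponent becomes that of the standard
normal distribution, and the determinant of the coordinate change is the square root of \<open>det V\<close>.
\<close>
lemma nn_integral_gauss_density_0:
  fixes V :: "real ^ 'n ^ 'n"
  assumes V: "pos_definite V"
  shows "(\<integral>\<^sup>+z. ennreal (gauss_density V z) \<partial>lborel) = 1"
proof -
  let ?M = "matrix_inv V"
  from pos_definite_orthonormalize[OF pos_definite_matrix_inv[OF V]]
  obtain B :: "real ^ 'n ^ 'n" where B: "transpose B ** ?M ** B = mat 1" .
  then have "det (transpose B ** ?M ** B) = 1" by simp
  then have "(det B)\<^sup>2 * det ?M = 1"
    by (simp add: det_mul power2_eq_square mult_ac)
  moreover have "det V * det ?M = 1"
    by (rule det_matrix_inv[OF pos_definite_invertible[OF V]])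
  ultimately have "(det B)\<^sup>2 = det V"
    by (metis mult_right_cancel mult_zero_right zero_neq_one)
  then have detB: "\<bar>det B\<bar> = sqrt (det V)" "det B \<noteq> 0"
    using pos_definite_det_pos[OF V] by (auto simp flip: real_sqrt_abs)
  have quad: "(B *v u) \<bullet> (?M *v (B *v u)) = u \<bullet> u" for u
  proof -
    have "(B *v u) \<bullet> (?M *v (B *v u)) = u \<bullet> ((transpose B ** ?M ** B) *v u)"
      by (metis inner_matrix_vector_swap matrix_vector_mul_assoc transpose_transpose)
    then show ?thesis by (simp add: B)
  qed
  define a where "a = 1 / sqrt ((2 * pi) ^ CARD('n) * det V)"
  have a: "a \<ge> 0"
    using pos_definite_det_pos[OF V] by (simp add: a_def)
  have "(\<integral>\<^sup>+z. ennreal (gauss_density V z) \<partial>lborel)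
      = ennreal \<bar>det B\<bar> * (\<integral>\<^sup>+u. ennreal (gauss_density V (B *v u)) \<partial>lborel)"
    by (rule nn_integral_lborel_matrix) (use detB in auto)
  also have "\<dots> = ennreal \<bar>det B\<bar> * (\<integral>\<^sup>+u. ennreal a * ennreal (exp (- (1 / 2) * (u \<bullet> u))) \<partial>(lborel :: (real ^ 'n) measure))"
    using a by (simp only: gauss_density_def quad a_def[symmetric]) (simp add: ennreal_mult)
  also have "\<dots> = ennreal \<bar>det B\<bar> * (ennreal a * ennreal (sqrt (2 * pi) ^ CARD('n)))"
    by (subst nn_integral_cmult, measurable) (use nn_integral_exp_norm_square[where 'a="real^'n"] in simp)
  also have "\<dots> = ennreal (\<bar>det B\<bar> * (a * sqrt (2 * pi) ^ CARD('n)))"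
    using a by (simp add: ennreal_mult)
  also have "\<bar>det B\<bar> * (a * sqrt (2 * pi) ^ CARD('n)) = 1"
    using pos_definite_det_pos[OF V]
    by (simp add: a_def detB real_sqrt_mult real_sqrt_power power_mult_distrib)
  finally show ?thesis by simp
qed

lemma nn_integral_lborel_diff:
  fixes f :: "'a::euclidean_space \<Rightarrow> ennreal"
  assumes [measurable]: "f \<in> borel_measurable borel"
  shows "(\<integral>\<^sup>+x. f (x - m) \<partial>lborel) = (\<integral>\<^sup>+x. f x \<partial>lborel)"
proof -
  have "(\<integral>\<^sup>+x. f x \<partial>distr lborel borel ((+) (- m))) = (\<integral>\<^sup>+x. f (- m + x) \<partial>lborel)"
    by (rule nn_integral_distr) auto
  then show ?thesis by (simp add: lborel_distr_plus)
qed

lemma nn_integral_gauss_density: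
  assumes "pos_definite V"
  shows "(\<integral>\<^sup>+z. ennreal (gauss_density V (z - m)) \<partial>lborel) = 1"
  using nn_integral_lborel_diff[of "\<lambda>z. ennreal (gauss_density V z)" m] nn_integral_gauss_density_0[OF assms]
  by simp

text \<open>
The shift \<open>k\<close> is the conditional expectation of a centred Gaussian \<open>w\<close> with covariance \<open>V\<close> given that
\<open>E w\<close> plus independent noise of covariance \<open>U\<close> takes the value \<open>c\<close>.  With \<open>q\<close> the image of \<open>c\<close> under the
inverse of \<open>W\<close>, the relation \<open>c - E k = U q\<close> makes all mixed terms cancel.
\<close>
lemma complete_square:
  fixes U V E :: "real ^ 'n ^ 'n"
  assumes V: "pos_definite V" and U: "pos_definite U"
    and W: "W = U + E ** V ** transpose E" "pos_definite W"
    and k: "k = V *v (transpose E *v (matrix_inv W *v c))"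
    and P: "P = matrix_inv V + transpose E ** matrix_inv U ** E"
  shows "w \<bullet> (matrix_inv V *v w) + (c - E *v w) \<bullet> (matrix_inv U *v (c - E *v w))
       = (w - k) \<bullet> (P *v (w - k)) + c \<bullet> (matrix_inv W *v c)"
proof -
  define q where "q = matrix_inv W *v c"
  define v where "v = w - k"
  define f where "f = E *v v"
  note iV = matrix_inv_mult_vec[OF pos_definite_invertible[OF V]]
    and iU = matrix_inv_mult_vec[OF pos_definite_invertible[OF U]]
  have sV: "x \<bullet> (matrix_inv V *v y) = (matrix_inv V *v x) \<bullet> y"
    and sU: "x \<bullet> (matrix_inv U *v y) = (matrix_inv U *v x) \<bullet> y" for x y
    using pos_definite_inner_commute pos_definite_matrix_inv U V by blast+
  have tE: "x \<bullet> (transpose E *v y) = (E *v x) \<bullet> y" for x y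
    by (metis inner_matrix_vector_swap transpose_transpose)
  have kq: "k = V *v (transpose E *v q)"
    by (simp only: k q_def)
  have Vk: "matrix_inv V *v k = transpose E *v q"
    by (simp only: kq iV)
  have "c = W *v q"
    by (simp add: q_def matrix_inv_mult_vec[OF pos_definite_invertible[OF W(2)]])
  then have c: "c = U *v q + E *v k"
    by (simp only: W(1) matrix_vector_mult_add_rdistrib kq matrix_vector_mul_assoc[symmetric])
  have w: "w = v + k" by (simp add: v_def)
  have "w \<bullet> (matrix_inv V *v w) = v \<bullet> (matrix_inv V *v v) + 2 * (f \<bullet> q) + (E *v k) \<bullet> q"
  proof -
    have "k \<bullet> (matrix_inv V *v v) = f \<bullet> q"
      by (metis sV Vk f_def tE inner_commute)
    moreover have "v \<bullet> (matrix_inv V *v k) = f \<bullet> q"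
      by (simp only: Vk tE f_def)
    moreover have "k \<bullet> (matrix_inv V *v k) = (E *v k) \<bullet> q"
      by (simp only: Vk tE)
    ultimately show ?thesis
      unfolding w matrix_vector_right_distrib inner_add_left inner_add_right by simp
  qed
  moreover have "(c - E *v w) \<bullet> (matrix_inv U *v (c - E *v w))
      = (U *v q) \<bullet> q - 2 * (f \<bullet> q) + f \<bullet> (matrix_inv U *v f)"
  proof -
    have cw: "c - E *v w = U *v q - f"
      by (simp add: c w f_def matrix_vector_right_distrib)
    have "(U *v q) \<bullet> (matrix_inv U *v f) = f \<bullet> q"
      by (simp only: sU iU inner_commute)
    then show ?thesis
      unfolding cw matrix_vector_mult_diff_distrib inner_diff_left inner_diff_right iU
      by (simp add: inner_commute)
  qed
  moreover have "v \<bullet> (P *v v) = v \<bullet> (matrix_inv V *v v) + f \<bullet> (matrix_inv U *v f)"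
    unfolding P matrix_vector_mult_add_rdistrib inner_add_right f_def
    by (simp only: matrix_vector_mul_assoc[symmetric] tE)
  moreover have "c \<bullet> q = (U *v q) \<bullet> q + (E *v k) \<bullet> q"
    by (simp only: c inner_add_left)
  ultimately show ?thesis
    by (simp add: q_def[symmetric] v_def[symmetric])
qed

text \<open>
After completing the square, the integral over \<open>y\<close> is a constant \<open>C\<close>, independent of \<open>z\<close>, times the
density on the right.  Both sides are probability densities in \<open>z\<close>, hence \<open>C = 1\<close>.
\<close>
lemma gauss_density_convolution:
  fixes U V E :: "real ^ 'n ^ 'n"
  assumes V: "pos_definite V" and U: "pos_definite U"
    and W: "pos_definite (U + E ** V ** transpose E)"
  shows "(\<integral>\<^sup>+y. ennreal (gauss_density V (y - m) * gauss_density U (z - E *v y)) \<partial>lborel)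
      = ennreal (gauss_density (U + E ** V ** transpose E) (z - E *v m))"
proof -
  define W' where "W' = U + E ** V ** transpose E"
  have W': "pos_definite W'" using W by (simp add: W'_def)
  define P where "P = matrix_inv V + transpose E ** matrix_inv U ** E"
  define a where "a X = 1 / sqrt ((2 * pi) ^ CARD('n) * det X)" for X :: "real ^ 'n ^ 'n"
  have a: "a X > 0" if "pos_definite X" for X
    using pos_definite_det_pos[OF that] by (simp add: a_def)
  have g: "gauss_density X x = a X * exp (- (1 / 2) * (x \<bullet> (matrix_inv X *v x)))" for X x
    by (simp add: gauss_density_def a_def)
  define K where "K = (\<integral>\<^sup>+y. ennreal (exp (- (1 / 2) * (y \<bullet> (P *v y)))) \<partial>lborel)"
  define C where "C = ennreal (a V * a U / a W') * K"
  have meas [measurable]: "(\<lambda>(z, y). gauss_density V (y - m) * gauss_density U (z - E *v y)) \<in> borel_measurable (borel \<Otimes>\<^sub>M borel)"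
    by measurable
  have conv: "(\<integral>\<^sup>+y. ennreal (gauss_density V (y - m) * gauss_density U (z - E *v y)) \<partial>lborel)
      = C * ennreal (gauss_density W' (z - E *v m))" for z
  proof -
    define c where "c = z - E *v m"
    define k where "k = V *v (transpose E *v (matrix_inv W' *v c))"
    have prod: "gauss_density V (y - m) * gauss_density U (z - E *v y)
      = a V * a U / a W' * gauss_density W' c * exp (- (1 / 2) * ((y - (m + k)) \<bullet> (P *v (y - (m + k)))))" for y
    proof -
      have zc: "z - E *v y = c - E *v (y - m)"
        by (simp add: c_def matrix_vector_mult_diff_distrib)
      have "gauss_density V (y - m) * gauss_density U (z - E *v y)
         = a V * a U * exp (- (1 / 2) * ((y - m) \<bullet> (matrix_inv V *v (y - m))
             + (c - E *v (y - m)) \<bullet> (matrix_inv U *v (c - E *v (y - m)))))"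
        by (simp only: g zc distrib_left exp_add mult_ac)
      also have "\<dots> = a V * a U * exp (- (1 / 2) * ((y - m - k) \<bullet> (P *v (y - m - k)) + c \<bullet> (matrix_inv W' *v c)))"
        by (subst complete_square[OF V U W'_def W' k_def P_def]) simp
      also have "\<dots> = a V * a U / a W' * gauss_density W' c * exp (- (1 / 2) * ((y - m - k) \<bullet> (P *v (y - m - k))))"
        by (simp only: g distrib_left exp_add) (use a[OF W'] in simp)
      finally show ?thesis by (simp only: diff_diff_eq)
    qed
    have "a V * a U / a W' * gauss_density W' c \<ge> 0"
      using a[OF U] a[OF V] a[OF W'] gauss_density_pos[OF W', of c] by simp
    then have "(\<integral>\<^sup>+y. ennreal (gauss_density V (y - m) * gauss_density U (z - E *v y)) \<partial>lborel)
      = (\<integral>\<^sup>+y. ennreal (a V * a U / a W' * gauss_density W' c) *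
           ennreal (exp (- (1 / 2) * ((y - (m + k)) \<bullet> (P *v (y - (m + k)))))) \<partial>lborel)"
      by (intro nn_integral_cong) (simp only: prod ennreal_mult')
    also have "\<dots> = ennreal (a V * a U / a W' * gauss_density W' c) * K"
      using nn_integral_lborel_diff[of "\<lambda>y. ennreal (exp (- (1 / 2) * (y \<bullet> (P *v y))))" "m + k"]
      by (subst nn_integral_cmult) (simp_all add: K_def)
    also have "\<dots> = C * ennreal (gauss_density W' (z - E *v m))"
    proof -
      have "0 \<le> a V * a U / a W'"
        using a[OF U] a[OF V] a[OF W'] by simp
      then show ?thesis
        unfolding C_def c_def[symmetric] by (simp only: ennreal_mult') (simp only: mult_ac)
    qed
    finally show ?thesis .
  qed
  have "C = C * (\<integral>\<^sup>+z. ennreal (gauss_density W' (z - E *v m)) \<partial>lborel)"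
    by (simp add: nn_integral_gauss_density[OF W'])
  also have "\<dots> = (\<integral>\<^sup>+z. \<integral>\<^sup>+y. ennreal (gauss_density V (y - m) * gauss_density U (z - E *v y)) \<partial>lborel \<partial>lborel)"
    by (subst nn_integral_cmult[symmetric]) (simp_all add: conv)
  also have "\<dots> = (\<integral>\<^sup>+y. \<integral>\<^sup>+z. ennreal (gauss_density V (y - m) * gauss_density U (z - E *v y)) \<partial>lborel \<partial>lborel)"
    by (intro lborel_pair.Fubini') (simp add: case_prod_beta')
  also have "\<dots> = (\<integral>\<^sup>+y. ennreal (gauss_density V (y - m)) * (\<integral>\<^sup>+z. ennreal (gauss_density U (z - E *v y)) \<partial>lborel) \<partial>lborel)"
    using gauss_density_pos[OF V]
    by (subst nn_integral_cmult[symmetric]) (simp_all add: ennreal_mult' less_imp_le)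
  also have "\<dots> = 1"
    by (simp add: nn_integral_gauss_density[OF U] nn_integral_gauss_density[OF V])
  finally show ?thesis
    by (simp add: conv W'_def)
qed

section \<open>Markov processes with prescribed transition densities\<close>

definition pred_time :: "real set \<Rightarrow> real \<Rightarrow> real" where
  "pred_time J t = Max (insert 0 {u \<in> J. u < t})"

lemma pred_time_mem:
  assumes "finite J" "J \<subseteq> {0<..}" "0 < t"
  shows "pred_time J t \<in> insert 0 J" "pred_time J t < t" "0 \<le> pred_time J t"
proof -
  have "pred_time J t \<in> insert 0 {u \<in> J. u < t}"
    unfolding pred_time_def using assms by (intro Max_in) auto
  then show "pred_time J t \<in> insert 0 J" "pred_time J t < t" "0 \<le> pred_time J t"
    using assms by auto
qed

lemma pred_time_eqI:
  assumes "finite J" "v \<in> insert 0 {u \<in> J. u < t}" "0 \<le> v" "\<And>u. u \<in> J \<Longrightarrow> u < t \<Longrightarrow> u \<le> v"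
  shows "pred_time J t = v"
  unfolding pred_time_def using assms by (intro Max_eqI) auto

lemma pred_time_insert_later:
  assumes "u \<le> t"
  shows "pred_time (insert t J) u = pred_time J u"
  unfolding pred_time_def using assms by (intro arg_cong[where f=Max]) auto

lemma pred_time_insert_earlier:
  assumes "finite J" "v \<in> J" "t < v" "v < u"
  shows "pred_time (insert t J) u = pred_time J u"
proof -
  let ?X = "insert 0 {u' \<in> J. u' < u}"
  have "t \<le> Max ?X"
    using assms by (intro order.trans[OF less_imp_le Max_ge]) auto
  moreover have "insert 0 {u' \<in> insert t J. u' < u} = insert t ?X"
    using assms by auto
  ultimately show ?thesis
    unfolding pred_time_def using assms by (simp add: max_absorb2)
qed

text \<open>
The Chapman-Kolmogorov equation is assumed at every \<open>z\<close>.  The density of a finite-dimensional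
distribution is a product in which the value at the later time also enters other factors, and a
pointwise equation can be used inside that product.
\<close>
locale markov_densities =
  fixes T :: real and p :: "real \<Rightarrow> real \<Rightarrow> 'a \<Rightarrow> 'a :: euclidean_space \<Rightarrow> real"
  assumes p_measurable: "\<And>s t. 0 \<le> s \<Longrightarrow> s < t \<Longrightarrow> t < T \<Longrightarrow>
      (\<lambda>(x, y). p s t x y) \<in> borel_measurable (borel \<Otimes>\<^sub>M borel)"
    and p_nonneg: "\<And>s t x y. 0 \<le> s \<Longrightarrow> s < t \<Longrightarrow> t < T \<Longrightarrow> 0 \<le> p s t x y"
    and p_mass: "\<And>s t x. 0 \<le> s \<Longrightarrow> s < t \<Longrightarrow> t < T \<Longrightarrow> (\<integral>\<^sup>+y. ennreal (p s t x y) \<partial>lborel) = 1"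
    and chapman_kolmogorov: "\<And>s t u x z. 0 \<le> s \<Longrightarrow> s < t \<Longrightarrow> t < u \<Longrightarrow> u < T \<Longrightarrow>
      ennreal (p s u x z) = (\<integral>\<^sup>+y. ennreal (p s t x y * p t u y z) \<partial>lborel)"
begin

abbreviation open_times :: "real set" where "open_times \<equiv> {0<..<T}"

text \<open>
The paths are only indexed by the times strictly between \<open>0\<close> and \<open>T\<close>; the starting point is \<open>0\<close>.
\<close>
definition at_time :: "(real \<Rightarrow> 'a) \<Rightarrow> real \<Rightarrow> 'a" where
  "at_time w u = (if u = 0 then 0 else w u)"

definition path_density :: "real set \<Rightarrow> (real \<Rightarrow> 'a) \<Rightarrow> ennreal" where
  "path_density J w = (\<Prod>t\<in>J. ennreal (p (pred_time J t) t (at_time w (pred_time J t)) (w t)))"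

lemma p_measurable_comp:
  assumes "0 \<le> s" "s < t" "t < T" "f \<in> borel_measurable M" "g \<in> borel_measurable M"
  shows "(\<lambda>w. p s t (f w) (g w)) \<in> borel_measurable M"
  using measurable_compose[OF measurable_Pair[OF assms(4,5)] p_measurable[OF assms(1-3)]] by simp

lemma at_time_measurable:
  assumes "u \<in> insert 0 J"
  shows "(\<lambda>w. at_time w u) \<in> borel_measurable (\<Pi>\<^sub>M i\<in>J. borel)"
  using assms by (cases "u = 0") (auto simp: at_time_def)

lemma path_density_measurable [measurable]:
  assumes "finite J" "J \<subseteq> open_times"
  shows "path_density J \<in> borel_measurable (\<Pi>\<^sub>M i\<in>J. lborel)"
proof -
  have "path_density J \<in> borel_measurable (\<Pi>\<^sub>M i\<in>J. borel)"
    unfolding path_density_def[abs_def]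
  proof (intro borel_measurable_prod_ennreal measurable_compose[OF _ measurable_ennreal] p_measurable_comp at_time_measurable)
    fix t assume "t \<in> J"
    moreover have "J \<subseteq> {0<..}" using assms by auto
    ultimately show "0 \<le> pred_time J t" "pred_time J t < t" "t < T" "pred_time J t \<in> insert 0 J"
      using pred_time_mem[OF assms(1), of t] assms by auto
    show "(\<lambda>w. w t) \<in> borel_measurable (\<Pi>\<^sub>M i\<in>J. borel)"
      using \<open>t \<in> J\<close> by simp
  qed
  also have "borel_measurable (\<Pi>\<^sub>M i\<in>J. borel) = borel_measurable (\<Pi>\<^sub>M i\<in>J. lborel)"
    by (intro measurable_cong_sets sets_PiM_cong) auto
  finally show ?thesis .
qed

lemma path_density_insert_last:
  assumes J: "finite J" "J \<subseteq> open_times" and t: "t \<in> open_times" and last: "\<And>u. u \<in> J \<Longrightarrow> u < t"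
  shows "path_density (insert t J) (w(t := y))
       = ennreal (p (pred_time J t) t (at_time w (pred_time J t)) y) * path_density J w"
proof -
  have "t \<notin> J" using last by auto
  have J0: "J \<subseteq> {0<..}" using J by auto
  have upd: "at_time (w(t := y)) (pred_time J u) = at_time w (pred_time J u)" if "u \<in> insert t J" for u
    using pred_time_mem(1)[OF J(1) J0, of u] J0 t that \<open>t \<notin> J\<close> by (auto simp: at_time_def)
  have "pred_time (insert t J) u = pred_time J u" if "u \<in> insert t J" for u
    using that last by (intro pred_time_insert_later) (auto intro: less_imp_le)
  then show ?thesis
    using \<open>t \<notin> J\<close> J upd by (auto simp: path_density_def intro!: arg_cong2[where f="(*)"] prod.cong)
qed

lemma path_density_insert_between:
  assumes J: "finite J" "J \<subseteq> open_times" and t: "t \<in> open_times" "t \<notin> J"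
    and b: "b \<in> J" "t < b" "\<And>u. u \<in> J \<Longrightarrow> t < u \<Longrightarrow> b \<le> u"
  shows "path_density (insert t J) (w(t := y))
       = (ennreal (p (pred_time J t) t (at_time w (pred_time J t)) y) * ennreal (p t b y (w b))) *
         (\<Prod>u\<in>J - {b}. ennreal (p (pred_time J u) u (at_time w (pred_time J u)) (w u)))"
    and "path_density J w = ennreal (p (pred_time J t) b (at_time w (pred_time J t)) (w b)) *
         (\<Prod>u\<in>J - {b}. ennreal (p (pred_time J u) u (at_time w (pred_time J u)) (w u)))"
proof -
  have J0: "J \<subseteq> {0<..}" using J by auto
  have upd: "at_time (w(t := y)) (pred_time J u) = at_time w (pred_time J u)" if "u \<in> insert t J" for u
    using pred_time_mem(1)[OF J(1) J0, of u] J0 t that by (auto simp: at_time_def)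
  have pb: "pred_time (insert t J) b = t"
    using J t b by (intro pred_time_eqI) (auto, force)
  have pJb: "pred_time J b = pred_time J t"
  proof (rule pred_time_eqI)
    show "pred_time J t \<in> insert 0 {u \<in> J. u < b}" "0 \<le> pred_time J t"
      using pred_time_mem[OF J(1) J0, of t] t b by auto
    fix u assume "u \<in> J" "u < b"
    with b t have "u < t" by (metis linorder_neqE not_less)
    then show "u \<le> pred_time J t"
      using \<open>u \<in> J\<close> J by (simp add: pred_time_def)
  qed (rule J)
  have pt: "pred_time (insert t J) t = pred_time J t"
    by (simp add: pred_time_insert_later)
  have pu: "pred_time (insert t J) u = pred_time J u" if u: "u \<in> J - {b}" for u
  proof (cases "u < t")
    case True
    then show ?thesis by (simp add: pred_time_insert_later)
  next
    case False
    then have "b < u" using u t b(3)[of u] by (cases "u = t") auto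
    then show ?thesis using J b by (intro pred_time_insert_earlier) auto
  qed
  have "(\<Prod>u\<in>J. ennreal (p (pred_time (insert t J) u) u (at_time (w(t := y)) (pred_time (insert t J) u)) ((w(t := y)) u)))
      = ennreal (p t b y (w b)) *
        (\<Prod>u\<in>J - {b}. ennreal (p (pred_time J u) u (at_time w (pred_time J u)) (w u)))"
  proof (subst prod.remove[of J b])
    show "ennreal (p (pred_time (insert t J) b) b (at_time (w(t := y)) (pred_time (insert t J) b)) ((w(t := y)) b)) *
        (\<Prod>u\<in>J - {b}. ennreal (p (pred_time (insert t J) u) u (at_time (w(t := y)) (pred_time (insert t J) u)) ((w(t := y)) u)))
      = ennreal (p t b y (w b)) *
        (\<Prod>u\<in>J - {b}. ennreal (p (pred_time J u) u (at_time w (pred_time J u)) (w u)))"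
      using t b by (intro arg_cong2[where f="(*)"] prod.cong refl) (auto simp: pb pu upd, auto simp: at_time_def)
  qed (use J b in auto)
  then show "path_density (insert t J) (w(t := y))
       = (ennreal (p (pred_time J t) t (at_time w (pred_time J t)) y) * ennreal (p t b y (w b))) *
         (\<Prod>u\<in>J - {b}. ennreal (p (pred_time J u) u (at_time w (pred_time J u)) (w u)))"
    using J t upd[of t] by (simp add: path_density_def pt mult.assoc)
  show "path_density J w = ennreal (p (pred_time J t) b (at_time w (pred_time J t)) (w b)) *
         (\<Prod>u\<in>J - {b}. ennreal (p (pred_time J u) u (at_time w (pred_time J u)) (w u)))"
    unfolding path_density_def using J b by (subst prod.remove[of J b]) (auto simp: pJb)
qed

text \<open>
Consistency of the finite-dimensional densities.  Integrating out a time \<open>t\<close> either leaves the total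
mass of a transition density, if \<open>t\<close> is the last time, or merges the two transitions that meet at \<open>t\<close>
by the Chapman-Kolmogorov equation.
\<close>
lemma nn_integral_path_density_insert:
  assumes J: "finite J" "J \<subseteq> open_times" and t: "t \<in> open_times" "t \<notin> J"
  shows "(\<integral>\<^sup>+y. path_density (insert t J) (w(t := y)) \<partial>lborel) = path_density J w"
proof -
  define a where "a = pred_time J t"
  have "J \<subseteq> {0<..}" using J by auto
  then have a: "0 \<le> a" "a < t"
    using pred_time_mem[OF J(1), of t] t by (auto simp: a_def)
  have [measurable]: "(\<lambda>y. p a t x y) \<in> borel_measurable borel" for x
    using a t by (intro p_measurable_comp) auto
  show ?thesis
  proof (cases "\<exists>u\<in>J. t < u")
    case False
    have last: "u < t" if "u \<in> J" for u
      using False that t by (metis linorder_neqE)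
    have "(\<integral>\<^sup>+y. path_density (insert t J) (w(t := y)) \<partial>lborel)
        = (\<integral>\<^sup>+y. ennreal (p a t (at_time w a) y) * path_density J w \<partial>lborel)"
      using J t(1) last unfolding a_def by (intro nn_integral_cong path_density_insert_last)
    also have "\<dots> = path_density J w"
      using a t by (subst nn_integral_multc) (auto simp: p_mass)
    finally show ?thesis .
  next
    case True
    define b where "b = Min {u \<in> J. t < u}"
    have "b \<in> {u \<in> J. t < u}"
      unfolding b_def using J True by (intro Min_in) auto
    moreover have "b \<le> u" if "u \<in> J" "t < u" for u
      unfolding b_def using J that by (intro Min_le) auto
    ultimately have b: "b \<in> J" "t < b" "\<And>u. u \<in> J \<Longrightarrow> t < u \<Longrightarrow> b \<le> u" by auto
    have "b < T" using b J by auto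
    have [measurable]: "(\<lambda>y. p t b y x) \<in> borel_measurable borel" for x
      using b t \<open>b < T\<close> by (intro p_measurable_comp) auto
    define R where "R = (\<Prod>u\<in>J - {b}. ennreal (p (pred_time J u) u (at_time w (pred_time J u)) (w u)))"
    have "(\<integral>\<^sup>+y. path_density (insert t J) (w(t := y)) \<partial>lborel)
        = (\<integral>\<^sup>+y. (ennreal (p a t (at_time w a) y) * ennreal (p t b y (w b))) * R \<partial>lborel)"
      unfolding a_def R_def by (intro nn_integral_cong path_density_insert_between(1) J t b)
    also have "\<dots> = (\<integral>\<^sup>+y. ennreal (p a t (at_time w a) y * p t b y (w b)) \<partial>lborel) * R"
      using a t b \<open>b < T\<close> by (subst nn_integral_multc) (auto simp: ennreal_mult' p_nonneg)
    also have "\<dots> = ennreal (p a b (at_time w a) (w b)) * R"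
      using a t b \<open>b < T\<close> by (subst chapman_kolmogorov[of a t b]) auto
    also have "\<dots> = path_density J w"
      unfolding a_def R_def by (intro path_density_insert_between(2)[symmetric] J t b)
    finally show ?thesis .
  qed
qed

definition fdd :: "real set \<Rightarrow> (real \<Rightarrow> 'a) measure" where
  "fdd J = density (\<Pi>\<^sub>M i\<in>J. lborel) (path_density J)"

lemma sets_PiM_lborel: "sets (\<Pi>\<^sub>M i\<in>J. lborel) = sets (\<Pi>\<^sub>M i\<in>J. borel)"
  by (intro sets_PiM_cong) auto

lemma sets_fdd: "sets (fdd J) = sets (\<Pi>\<^sub>M i\<in>J. borel)"
  by (simp add: fdd_def sets_PiM_lborel)

lemma borel_measurable_PiM_lborel:
  "borel_measurable (\<Pi>\<^sub>M i\<in>J. lborel) = borel_measurable (\<Pi>\<^sub>M i\<in>J. borel)"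
  by (intro measurable_cong_sets sets_PiM_lborel refl)

lemma nn_integral_fdd:
  assumes "finite J" "J \<subseteq> open_times" "f \<in> borel_measurable (\<Pi>\<^sub>M i\<in>J. borel)"
  shows "integral\<^sup>N (fdd J) f = (\<integral>\<^sup>+w. path_density J w * f w \<partial>(\<Pi>\<^sub>M i\<in>J. lborel))"
  unfolding fdd_def using assms by (intro nn_integral_density) (simp_all add: borel_measurable_PiM_lborel path_density_measurable)

lemma nn_integral_fdd_restrict:
  assumes H: "finite H" "H \<subseteq> open_times" and J: "J \<subseteq> H"
    and f: "f \<in> borel_measurable (\<Pi>\<^sub>M i\<in>J. borel)"
  shows "(\<integral>\<^sup>+w. f (restrict w J) \<partial>fdd H) = integral\<^sup>N (fdd J) f"
proof -
  interpret product_sigma_finite "\<lambda>_. lborel :: 'a measure" ..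
  have fJ: "finite J" using H J finite_subset by blast
  have "(\<integral>\<^sup>+w. f (restrict w J) \<partial>fdd (J \<union> K)) = integral\<^sup>N (fdd J) f"
    if "finite K" "K \<inter> J = {}" "J \<union> K \<subseteq> open_times" for K
    using that
  proof (induction K)
    case empty
    have "(\<integral>\<^sup>+w. f (restrict w J) \<partial>fdd J) = integral\<^sup>N (fdd J) f"
      by (intro nn_integral_cong arg_cong[where f=f])
        (auto simp: fdd_def space_PiM PiE_def extensional_restrict)
    then show ?case by (simp only: Un_empty_right)
  next
    case (insert t K)
    let ?L = "J \<union> K"
    have L: "finite ?L" "?L \<subseteq> open_times" "t \<in> open_times" "t \<notin> ?L"
      using insert fJ by auto
    have fr: "(\<lambda>w. f (restrict w J)) \<in> borel_measurable (\<Pi>\<^sub>M i\<in>insert t ?L. borel)"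
      "(\<lambda>w. f (restrict w J)) \<in> borel_measurable (\<Pi>\<^sub>M i\<in>?L. borel)"
      by (rule measurable_compose[OF measurable_restrict_subset f], auto)+
    have pd: "path_density (insert t ?L) \<in> borel_measurable (\<Pi>\<^sub>M i\<in>insert t ?L. lborel)"
      using L by (intro path_density_measurable) auto
    have rw: "restrict (w(t := y)) J = restrict w J" for w y
      using L by (auto simp: restrict_def)
    have "(\<integral>\<^sup>+w. f (restrict w J) \<partial>fdd (insert t ?L))
       = (\<integral>\<^sup>+w. path_density (insert t ?L) w * f (restrict w J) \<partial>(\<Pi>\<^sub>M i\<in>insert t ?L. lborel))"
      using L fr by (intro nn_integral_fdd) auto
    also have "\<dots> = (\<integral>\<^sup>+w. \<integral>\<^sup>+y. path_density (insert t ?L) (w(t := y)) * f (restrict (w(t := y)) J) \<partial>lborel \<partial>(\<Pi>\<^sub>M i\<in>?L. lborel))"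
    proof (rule product_nn_integral_insert)
      show "(\<lambda>w. path_density (insert t ?L) w * f (restrict w J)) \<in> borel_measurable (\<Pi>\<^sub>M i\<in>insert t ?L. lborel)"
        using pd fr(1) by (intro borel_measurable_times_ennreal) (simp_all only: borel_measurable_PiM_lborel)
    qed (use L in auto)
    also have "\<dots> = (\<integral>\<^sup>+w. path_density ?L w * f (restrict w J) \<partial>(\<Pi>\<^sub>M i\<in>?L. lborel))"
    proof (rule nn_integral_cong)
      fix w assume w: "w \<in> space (\<Pi>\<^sub>M i\<in>?L. lborel :: 'a measure)"
      have "(\<lambda>y. path_density (insert t ?L) (w(t := y))) \<in> borel_measurable lborel"
        by (rule measurable_compose[OF measurable_component_update[OF w L(4)] pd])
      then show "(\<integral>\<^sup>+y. path_density (insert t ?L) (w(t := y)) * f (restrict (w(t := y)) J) \<partial>lborel)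
          = path_density ?L w * f (restrict w J)"
        unfolding rw by (subst nn_integral_multc) (simp_all only: nn_integral_path_density_insert[OF L])
    qed
    also have "\<dots> = (\<integral>\<^sup>+w. f (restrict w J) \<partial>fdd ?L)"
      using L fr by (intro nn_integral_fdd[symmetric]) auto
    also have "\<dots> = integral\<^sup>N (fdd J) f"
      using insert.prems by (intro insert.IH) auto
    finally show ?case
      by (simp only: Un_insert_right)
  qed
  from this[of "H - J"] H J show ?thesis
    by (simp add: Un_absorb1 Int_commute)
qed

lemma prob_space_fdd:
  assumes "finite J" "J \<subseteq> open_times"
  shows "prob_space (fdd J)"
proof
  have "emeasure (fdd J) (space (fdd J)) = integral\<^sup>N (fdd J) (\<lambda>_. 1)"
    by simp
  also have "\<dots> = integral\<^sup>N (fdd {}) (\<lambda>_. 1)"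
    using nn_integral_fdd_restrict[OF assms, of "{}" "\<lambda>_. 1"] by simp
  also have "\<dots> = (\<integral>\<^sup>+w. path_density {} w * 1 \<partial>(\<Pi>\<^sub>M i\<in>({} :: real set). lborel))"
    by (rule nn_integral_fdd) auto
  also have "\<dots> = (\<integral>\<^sup>+w. 1 \<partial>(\<Pi>\<^sub>M i\<in>({} :: real set). lborel :: 'a measure))"
    by (simp add: path_density_def)
  also have "\<dots> = emeasure (\<Pi>\<^sub>M i\<in>({} :: real set). lborel :: 'a measure) {\<lambda>_. undefined}"
    by (simp only: nn_integral_const mult_1) (simp add: space_PiM)
  also have "\<dots> = 1"
    by (rule emeasure_PiM_empty)
  finally show "emeasure (fdd J) (space (fdd J)) = 1" .
qed

lemma fdd_eq_distr:
  assumes H: "finite H" "H \<subseteq> open_times" and J: "J \<subseteq> H"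
  shows "fdd J = distr (fdd H) (\<Pi>\<^sub>M i\<in>J. borel) (\<lambda>w. restrict w J)"
proof (rule measure_eqI)
  have m: "(\<lambda>w. restrict w J) \<in> measurable (fdd H) (\<Pi>\<^sub>M i\<in>J. borel)"
    using measurable_restrict_subset[OF J] by (simp add: measurable_cong_sets[OF sets_fdd refl])
  fix A assume "A \<in> sets (fdd J)"
  then have A: "A \<in> sets (\<Pi>\<^sub>M i\<in>J. borel)" by (simp add: sets_fdd)
  have "emeasure (fdd J) A = integral\<^sup>N (fdd J) (indicator A)"
    using A by (simp add: sets_fdd)
  also have "\<dots> = (\<integral>\<^sup>+w. indicator A (restrict w J) \<partial>fdd H)"
    by (rule nn_integral_fdd_restrict[OF H J, symmetric]) (use A in auto)
  also have "\<dots> = (\<integral>\<^sup>+w. indicator A w \<partial>distr (fdd H) (\<Pi>\<^sub>M i\<in>J. borel) (\<lambda>w. restrict w J))"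
    by (rule nn_integral_distr[OF m, symmetric]) (use A in auto)
  finally show "emeasure (fdd J) A = emeasure (distr (fdd H) (\<Pi>\<^sub>M i\<in>J. borel) (\<lambda>w. restrict w J)) A"
    using A by simp
qed (simp add: sets_fdd)

text \<open>
The hypotheses of Kolmogorov's extension theorem, whose limit measure is the law of the process.
\<close>
sublocale path_space: polish_projective open_times fdd
proof (intro polish_projective.intro projective_family.intro)
  show "fdd J = distr (fdd H) (\<Pi>\<^sub>M i\<in>J. borel) (\<lambda>w. restrict w J)"
    if "J \<subseteq> H" "finite H" "H \<subseteq> open_times" for J H
    using that by (intro fdd_eq_distr)
  show "prob_space (fdd J)" if "finite J" "J \<subseteq> open_times" for J
    using that by (rule prob_space_fdd)
qed

abbreviation path_measure :: "(real \<Rightarrow> 'a) measure" where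
  "path_measure \<equiv> path_space.lim"

definition coord :: "real \<Rightarrow> (real \<Rightarrow> 'a) \<Rightarrow> 'a" where
  "coord t w = (if t \<in> open_times then w t else 0)"

lemma coord_measurable [measurable]: "coord t \<in> borel_measurable path_measure"
proof -
  have "coord t \<in> borel_measurable (\<Pi>\<^sub>M i\<in>open_times. borel)"
    by (cases "t \<in> open_times") (auto simp: coord_def[abs_def])
  then show ?thesis
    by (simp add: measurable_cong_sets[OF path_space.sets_lim refl])
qed

lemma restrict_measurable:
  assumes "J \<subseteq> open_times"
  shows "(\<lambda>w. restrict w J) \<in> measurable path_measure (\<Pi>\<^sub>M i\<in>J. borel)"
  using measurable_restrict_subset[OF assms] by (simp add: measurable_cong_sets[OF path_space.sets_lim refl])

lemma nn_integral_path_measure: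
  assumes J: "finite J" "J \<subseteq> open_times" and f: "f \<in> borel_measurable (\<Pi>\<^sub>M i\<in>J. borel)"
  shows "(\<integral>\<^sup>+w. f (restrict w J) \<partial>path_measure) = (\<integral>\<^sup>+w. path_density J w * f w \<partial>(\<Pi>\<^sub>M i\<in>J. lborel))"
proof -
  have "distr path_measure (\<Pi>\<^sub>M i\<in>J. borel) (\<lambda>w. restrict w J) = fdd J"
  proof (rule measure_eqI)
    fix A assume "A \<in> sets (distr path_measure (\<Pi>\<^sub>M i\<in>J. borel) (\<lambda>w. restrict w J))"
    then have A: "A \<in> sets (\<Pi>\<^sub>M i\<in>J. borel)" by simp
    have "emeasure (distr path_measure (\<Pi>\<^sub>M i\<in>J. borel) (\<lambda>w. restrict w J)) A
      = emeasure path_measure (path_space.emb open_times J A)"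
      using A restrict_measurable[OF J(2)] by (simp add: emeasure_distr prod_emb_def space_PiM)
    also have "\<dots> = emeasure (fdd J) A"
      using J A by (intro path_space.emeasure_lim_emb)
    finally show "emeasure (distr path_measure (\<Pi>\<^sub>M i\<in>J. borel) (\<lambda>w. restrict w J)) A = emeasure (fdd J) A" .
  qed (simp add: sets_fdd)
  moreover have "f \<in> borel_measurable (fdd J)"
    using f by (simp add: measurable_cong_sets[OF sets_fdd refl])
  ultimately have "integral\<^sup>N (fdd J) f = (\<integral>\<^sup>+w. f (restrict w J) \<partial>path_measure)"
    using nn_integral_distr[OF restrict_measurable[OF J(2)], of f] f by simp
  then show ?thesis
    by (simp add: nn_integral_fdd[OF J f])
qed

lemma coord_measurable_past:
  assumes "u \<le> s"
  shows "coord u \<in> borel_measurable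
    (vimage_algebra (space path_measure) (\<lambda>w. restrict w (open_times \<inter> {..s})) (\<Pi>\<^sub>M i\<in>open_times \<inter> {..s}. borel))"
    (is "_ \<in> borel_measurable ?V")
proof (cases "u \<in> open_times")
  case True
  have "(\<lambda>w. restrict w (open_times \<inter> {..s})) \<in> measurable ?V (\<Pi>\<^sub>M i\<in>open_times \<inter> {..s}. borel)"
    by (intro measurable_vimage_algebra1) (auto simp: space_PiM)
  moreover have "(\<lambda>w. w u) \<in> borel_measurable (\<Pi>\<^sub>M i\<in>open_times \<inter> {..s}. borel)"
    using True assms by (intro measurable_component_singleton) auto
  ultimately have "(\<lambda>w. restrict w (open_times \<inter> {..s}) u) \<in> borel_measurable ?V"
    by (rule measurable_compose)
  also have "(\<lambda>w. restrict w (open_times \<inter> {..s}) u) = coord u"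
    using True assms by (auto simp: coord_def)
  finally show ?thesis .
next
  case False
  then have "coord u = (\<lambda>_. 0)" by (auto simp: coord_def)
  then show ?thesis by simp
qed

lemma sets_past_sigma_coord:
  "sets (past_sigma path_measure K coord s) =
     sigma_sets (space path_measure) {coord u -` B \<inter> space path_measure | u B. u \<in> K \<and> u \<le> s \<and> B \<in> sets borel}"
  unfolding past_sigma_def by (rule sets_measure_of) auto

lemma past_sigma_subset:
  "sets (past_sigma path_measure K coord s) \<subseteq>
     sets (vimage_algebra (space path_measure) (\<lambda>w. restrict w (open_times \<inter> {..s})) (\<Pi>\<^sub>M i\<in>open_times \<inter> {..s}. borel))"
    (is "_ \<subseteq> sets ?V")
proof -
  have sp: "space ?V = space path_measure"
    by (simp add: space_vimage_algebra)
  have "{coord u -` B \<inter> space path_measure | u B. u \<in> K \<and> u \<le> s \<and> B \<in> sets borel} \<subseteq> sets ?V"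
    using coord_measurable_past[THEN measurable_sets, of _ s] by (auto simp: sp)
  from sets.sigma_sets_subset[OF this] show ?thesis
    by (simp add: sets_past_sigma_coord space_vimage_algebra)
qed

text \<open>
The Markov property on cylinder sets.  If \<open>t\<close> is later than all of \<open>J\<close> and \<open>s\<close>, and \<open>s\<close> is the last time
before \<open>t\<close>, then the factor of the path density that involves \<open>t\<close> is the transition density from \<open>s\<close>
to \<open>t\<close>, and the remaining factors form the path density without \<open>t\<close>.
\<close>
lemma nn_integral_transition:
  assumes st: "0 \<le> s" "s < t" "t < T" and B: "B \<in> sets borel"
    and J: "finite J" "J \<subseteq> open_times \<inter> {..s}" and E: "E \<in> sets (\<Pi>\<^sub>M i\<in>J. borel)"
  shows "(\<integral>\<^sup>+w. indicator E (restrict w J) * indicator B (coord t w) \<partial>path_measure)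
       = (\<integral>\<^sup>+w. indicator E (restrict w J) * (\<integral>\<^sup>+y\<in>B. ennreal (p s t (coord s w) y) \<partial>lborel) \<partial>path_measure)"
proof -
  interpret product_sigma_finite "\<lambda>_. lborel :: 'a measure" ..
  note B [measurable] and E [measurable]
  \<comment> \<open>at \<open>s = 0\<close> there is no coordinate; the value is the deterministic starting point\<close>
  define L where "L = (if s = 0 then J else insert s J)"
  have L: "finite L" "L \<subseteq> open_times" "t \<in> open_times" "\<And>u. u \<in> L \<Longrightarrow> u < t" "t \<notin> L" "J \<subseteq> L"
    using J st by (auto simp: L_def split: if_splits)
  have H: "finite (insert t L)" "insert t L \<subseteq> open_times"
    using L by auto
  have pt: "pred_time L t = s"
    using L J st by (intro pred_time_eqI) (auto simp: L_def split: if_splits)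
  have sL: "s \<in> insert 0 L" by (simp add: L_def)
  define g where "g x = (\<integral>\<^sup>+y\<in>B. ennreal (p s t x y) \<partial>lborel)" for x
  have g [measurable]: "g \<in> borel_measurable borel"
    unfolding g_def
    by (intro lborel.borel_measurable_nn_integral)
      (use p_measurable[OF st] in \<open>simp add: case_prod_beta'\<close>)
  have [measurable]: "(\<lambda>w. restrict w J) \<in> measurable (\<Pi>\<^sub>M i\<in>insert t L. borel) (\<Pi>\<^sub>M i\<in>J. borel)"
    "(\<lambda>w. restrict w J) \<in> measurable (\<Pi>\<^sub>M i\<in>L. borel) (\<Pi>\<^sub>M i\<in>J. borel)"
    using L by (auto intro: measurable_restrict_subset)
  have mt [measurable]: "(\<lambda>w. w t) \<in> borel_measurable (\<Pi>\<^sub>M i\<in>insert t L. borel)"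
    by simp
  have pd: "path_density (insert t L) \<in> borel_measurable (\<Pi>\<^sub>M i\<in>insert t L. borel)"
    using path_density_measurable[OF H] by (simp only: borel_measurable_PiM_lborel)
  have rr: "restrict (restrict w (insert t L)) J = restrict w J" "restrict (restrict w L) J = restrict w J" for w :: "real \<Rightarrow> 'a"
    using L(6) by (auto simp: restrict_def fun_eq_iff)
  have ct: "coord t w = restrict w (insert t L) t" for w
    using L by (simp add: coord_def)
  have cs: "coord s w = at_time (restrict w L) s" for w
    using sL L(2) st by (auto simp: coord_def at_time_def)
  have rw: "restrict (w(t := y)) J = restrict w J" for w :: "real \<Rightarrow> 'a" and y
    using L(5,6) by (auto simp: restrict_def fun_eq_iff)
  let ?h = "\<lambda>w. indicator E (restrict w J) * indicator B (w t) :: ennreal"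
  have h: "?h \<in> borel_measurable (\<Pi>\<^sub>M i\<in>insert t L. borel)"
    by measurable
  have "(\<integral>\<^sup>+w. indicator E (restrict w J) * indicator B (coord t w) \<partial>path_measure)
      = (\<integral>\<^sup>+w. ?h (restrict w (insert t L)) \<partial>path_measure)"
    by (simp only: ct rr)
  also have "\<dots> = (\<integral>\<^sup>+w. path_density (insert t L) w * ?h w \<partial>(\<Pi>\<^sub>M i\<in>insert t L. lborel))"
    by (rule nn_integral_path_measure[OF H h])
  also have "\<dots> = (\<integral>\<^sup>+w. \<integral>\<^sup>+y. path_density (insert t L) (w(t := y)) * ?h (w(t := y)) \<partial>lborel \<partial>(\<Pi>\<^sub>M i\<in>L. lborel))"
  proof (rule product_nn_integral_insert)
    show "(\<lambda>w. path_density (insert t L) w * ?h w) \<in> borel_measurable (\<Pi>\<^sub>M i\<in>insert t L. lborel)"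
      unfolding borel_measurable_PiM_lborel by (rule borel_measurable_times_ennreal[OF pd h])
  qed (use L in auto)
  also have "\<dots> = (\<integral>\<^sup>+w. path_density L w * (indicator E (restrict w J) * g (at_time w s)) \<partial>(\<Pi>\<^sub>M i\<in>L. lborel))"
  proof (rule nn_integral_cong)
    fix w :: "real \<Rightarrow> 'a"
    have m: "(\<lambda>y. p s t x y) \<in> borel_measurable borel" for x
      using st by (intro p_measurable_comp) auto
    have "path_density (insert t L) (w(t := y)) * ?h (w(t := y))
        = (path_density L w * indicator E (restrict w J)) * (ennreal (p s t (at_time w s) y) * indicator B y)" for y
      using path_density_insert_last[OF L(1-4), of w y] by (simp only: rw pt fun_upd_same mult_ac)
    then have "(\<integral>\<^sup>+y. path_density (insert t L) (w(t := y)) * ?h (w(t := y)) \<partial>lborel)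
        = (\<integral>\<^sup>+y. (path_density L w * indicator E (restrict w J)) * (ennreal (p s t (at_time w s) y) * indicator B y) \<partial>lborel)"
      by (intro nn_integral_cong)
    also have "\<dots> = (path_density L w * indicator E (restrict w J)) * g (at_time w s)"
      unfolding g_def using m by (intro nn_integral_cmult) auto
    finally show "(\<integral>\<^sup>+y. path_density (insert t L) (w(t := y)) * ?h (w(t := y)) \<partial>lborel)
        = path_density L w * (indicator E (restrict w J) * g (at_time w s))"
      by (simp only: mult.assoc)
  qed
  also have "\<dots> = (\<integral>\<^sup>+w. (\<lambda>w. indicator E (restrict w J) * g (at_time w s)) (restrict w L) \<partial>path_measure)"
  proof (rule nn_integral_path_measure[symmetric, OF L(1,2)])
    have [measurable]: "(\<lambda>w. at_time w s) \<in> borel_measurable (\<Pi>\<^sub>M i\<in>L. borel)"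
      by (rule at_time_measurable[OF sL])
    show "(\<lambda>w. indicator E (restrict w J) * g (at_time w s)) \<in> borel_measurable (\<Pi>\<^sub>M i\<in>L. borel)"
      by measurable
  qed
  also have "\<dots> = (\<integral>\<^sup>+w. indicator E (restrict w J) * g (coord s w) \<partial>path_measure)"
    by (simp only: cs rr)
  finally show ?thesis by (simp only: g_def)
qed

text \<open>
Both sides are finite measures in \<open>A\<close>, and the past up to \<open>s\<close> is generated by the restriction of the path
to the times up to \<open>s\<close>.  Two finite measures on a product space that agree on boxes over finitely
many coordinates are equal.
\<close>
lemma nn_integral_transition_past:
  assumes st: "0 \<le> s" "s < t" "t < T" and B: "B \<in> sets borel"
    and A: "A \<in> sets (past_sigma path_measure K coord s)"
  shows "(\<integral>\<^sup>+w. indicator A w * indicator B (coord t w) \<partial>path_measure)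
       = (\<integral>\<^sup>+w. indicator A w * (\<integral>\<^sup>+y\<in>B. ennreal (p s t (coord s w) y) \<partial>lborel) \<partial>path_measure)"
proof -
  note B [measurable]
  let ?I = "open_times \<inter> {..s}"
  let ?S = "\<Pi>\<^sub>M i\<in>?I. borel :: 'a measure"
  let ?\<rho> = "\<lambda>w. restrict w ?I"
  define g where "g x = (\<integral>\<^sup>+y\<in>B. ennreal (p s t x y) \<partial>lborel)" for x
  have g [measurable]: "g \<in> borel_measurable borel"
    unfolding g_def
    by (intro lborel.borel_measurable_nn_integral)
      (use p_measurable[OF st] in \<open>simp add: case_prod_beta'\<close>)
  have r: "?\<rho> \<in> measurable path_measure ?S"
    by (rule restrict_measurable) auto
  define P where "P = distr (density path_measure (\<lambda>w. indicator B (coord t w))) ?S ?\<rho>"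
  define Q where "Q = distr (density path_measure (\<lambda>w. g (coord s w))) ?S ?\<rho>"
  have em: "emeasure (distr (density path_measure f) ?S ?\<rho>) E = (\<integral>\<^sup>+w. indicator E (?\<rho> w) * f w \<partial>path_measure)"
    if E: "E \<in> sets ?S" and f: "f \<in> borel_measurable path_measure" for E f
  proof -
    have "emeasure (distr (density path_measure f) ?S ?\<rho>) E = emeasure (density path_measure f) (?\<rho> -` E \<inter> space path_measure)"
      using E r by (simp add: emeasure_distr)
    also have "\<dots> = (\<integral>\<^sup>+w. f w * indicator (?\<rho> -` E \<inter> space path_measure) w \<partial>path_measure)"
      by (rule emeasure_density[OF f]) (rule measurable_sets[OF r E])
    also have "\<dots> = (\<integral>\<^sup>+w. indicator E (?\<rho> w) * f w \<partial>path_measure)"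
      by (intro nn_integral_cong) (auto simp: indicator_def)
    finally show ?thesis .
  qed
  have "P = Q"
  proof (rule measure_eqI_PiM_infinite)
    show "sets P = sets ?S" "sets Q = sets ?S"
      by (simp_all add: P_def Q_def)
    have "emeasure P (space P) \<le> emeasure path_measure (space path_measure)"
    proof -
      have "emeasure P (space P) = (\<integral>\<^sup>+w. indicator (space ?S) (?\<rho> w) * indicator B (coord t w) \<partial>path_measure)"
        unfolding P_def by (subst em[symmetric]) auto
      also have "\<dots> \<le> (\<integral>\<^sup>+w. 1 \<partial>path_measure)"
        by (intro nn_integral_mono) (auto simp: indicator_def)
      finally show ?thesis by simp
    qed
    then show "finite_measure P"
      by (intro finite_measureI) (auto simp: path_space.P.emeasure_space_1 top_unique)
    fix A :: "real \<Rightarrow> 'a set" and J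
    assume J: "finite J" "J \<subseteq> ?I" and A: "\<And>i. i \<in> J \<Longrightarrow> A i \<in> sets borel"
    let ?E = "Pi\<^sub>E J A"
    let ?F = "prod_emb ?I (\<lambda>_. borel :: 'a measure) J ?E"
    have E: "?E \<in> sets (\<Pi>\<^sub>M i\<in>J. borel)"
      using J A by (intro sets_PiM_I_finite) auto
    have F: "?F \<in> sets ?S"
      using J E by (intro measurable_prod_emb)
    have i: "indicator ?F (?\<rho> w) = (indicator ?E (restrict w J) :: ennreal)" for w
    proof -
      have "restrict (?\<rho> w) J = restrict w J"
        using J by (auto simp: restrict_def fun_eq_iff)
      then show ?thesis
        by (auto simp: indicator_def prod_emb_def)
    qed
    show "emeasure P ?F = emeasure Q ?F"
      unfolding P_def Q_def
      using nn_integral_transition[OF st B J E]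
      by (subst (1 2) em[OF F]) (simp_all only: i g_def[symmetric], measurable)
  qed
  from A past_sigma_subset have "A \<in> sets (vimage_algebra (space path_measure) ?\<rho> ?S)"
    by blast
  moreover have "?\<rho> \<in> space path_measure \<rightarrow> space ?S"
    by (auto simp: space_PiM)
  ultimately obtain E where E: "E \<in> sets ?S" "A = ?\<rho> -` E \<inter> space path_measure"
    by (auto simp: sets_vimage_algebra2)
  have "(\<integral>\<^sup>+w. indicator A w * f w \<partial>path_measure) = (\<integral>\<^sup>+w. indicator E (?\<rho> w) * f w \<partial>path_measure)" for f
    unfolding E(2) by (intro nn_integral_cong) (auto simp: indicator_def)
  moreover have "(\<integral>\<^sup>+w. indicator E (?\<rho> w) * indicator B (coord t w) \<partial>path_measure) = (\<integral>\<^sup>+w. indicator E (?\<rho> w) * g (coord s w) \<partial>path_measure)"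
    using \<open>P = Q\<close> unfolding P_def Q_def
    by (subst (1 2) em[OF E(1), symmetric]) (simp_all, measurable)
  ultimately show ?thesis by (simp only: g_def)
qed

lemma subalgebra_past_sigma: "subalgebra path_measure (past_sigma path_measure K coord s)"
proof -
  have "{coord u -` B \<inter> space path_measure | u B. u \<in> K \<and> u \<le> s \<and> B \<in> sets borel} \<subseteq> sets path_measure"
    using measurable_sets[OF coord_measurable] by (auto simp del: path_space.sets_lim path_space.space_lim)
  from sets.sigma_sets_subset[OF this] show ?thesis
    by (simp add: subalgebra_def sets_past_sigma_coord) (simp add: past_sigma_def space_measure_of_conv)
qed

lemma subalgebra_coord: "subalgebra path_measure (vimage_algebra (space path_measure) (coord s) borel)"
  unfolding subalgebra_def
  using coord_measurable[of s] by (auto simp: measurable_iff_sets)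

lemma coord_measurable_present:
  "coord s \<in> borel_measurable (vimage_algebra (space path_measure) (coord s) borel)"
  by (intro measurable_vimage_algebra1) auto

lemma present_subset_past:
  assumes "s \<in> K"
  shows "sets (vimage_algebra (space path_measure) (coord s) borel) \<subseteq> sets (past_sigma path_measure K coord s)"
proof -
  have "sets (vimage_algebra (space path_measure) (coord s) borel) = {coord s -` B \<inter> space path_measure | B. B \<in> sets borel}"
    by (intro sets_vimage_algebra2) auto
  then show ?thesis
    unfolding sets_past_sigma_coord using assms by (auto intro!: sigma_sets.Basic)
qed

text \<open>
Stated for every sigma-algebra between the present and the past at time \<open>s\<close>: applied to the past and to
the present it yields the Markov property, and applied to the present alone it identifies the
transition densities.
\<close>
lemma real_cond_exp_transition:
  assumes st: "0 \<le> s" "s < t" "t < T" and B: "B \<in> sets borel"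
    and F: "subalgebra path_measure F" "sets F \<subseteq> sets (past_sigma path_measure K coord s)"
    and X: "coord s \<in> borel_measurable F"
  shows "AE w in path_measure. real_cond_exp path_measure F (\<lambda>w. indicator B (coord t w)) w
      = (LINT y:B|lborel. p s t (coord s w) y)"
proof -
  interpret finite_measure_subalgebra path_measure F
    by unfold_locales (rule F)
  note B [measurable]
  define G where "G x = (LINT y:B|lborel. p s t x y)" for x
  have G [measurable]: "G \<in> borel_measurable borel"
    unfolding G_def set_lebesgue_integral_def
    by (intro lborel.borel_measurable_lebesgue_integral)
      (use p_measurable[OF st] in \<open>simp add: case_prod_beta'\<close>)
  have m: "(\<lambda>y. p s t x y) \<in> borel_measurable borel" for x
    using st by (intro p_measurable_comp) auto
  have le1: "(\<integral>\<^sup>+y\<in>B. ennreal (p s t x y) \<partial>lborel) \<le> 1" for x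
  proof -
    have "(\<integral>\<^sup>+y\<in>B. ennreal (p s t x y) \<partial>lborel) \<le> (\<integral>\<^sup>+y. ennreal (p s t x y) \<partial>lborel)"
      by (intro nn_integral_mono) (auto simp: indicator_def)
    then show ?thesis using p_mass[OF st] by simp
  qed
  have Geq: "G x = enn2real (\<integral>\<^sup>+y\<in>B. ennreal (p s t x y) \<partial>lborel)" for x
  proof -
    have "G x = enn2real (\<integral>\<^sup>+y. ennreal (indicator B y *\<^sub>R p s t x y) \<partial>lborel)"
      unfolding G_def set_lebesgue_integral_def
      using m p_nonneg[OF st] by (intro integral_eq_nn_integral) auto
    also have "(\<integral>\<^sup>+y. ennreal (indicator B y *\<^sub>R p s t x y) \<partial>lborel) = (\<integral>\<^sup>+y\<in>B. ennreal (p s t x y) \<partial>lborel)"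
      by (intro nn_integral_cong) (auto simp: indicator_def)
    finally show ?thesis .
  qed
  have G0: "0 \<le> G x" for x by (simp add: Geq)
  have eG: "ennreal (G x) = (\<integral>\<^sup>+y\<in>B. ennreal (p s t x y) \<partial>lborel)" for x
    unfolding Geq using le1[of x] by (intro ennreal_enn2real) (auto simp: less_top[symmetric] top_unique)
  have G1: "G x \<le> 1" for x
    using le1[of x] unfolding eG[symmetric] by simp
  have "AE w in path_measure. real_cond_exp path_measure F (\<lambda>w. indicator B (coord t w)) w = G (coord s w)"
  proof (rule real_cond_exp_charact)
    show "integrable path_measure (\<lambda>w. indicator B (coord t w) :: real)"
      by (intro path_space.P.integrable_const_bound[where B=1]) (auto simp: indicator_def)
    show "integrable path_measure (\<lambda>w. G (coord s w))"
      using G0 G1 by (intro path_space.P.integrable_const_bound[where B=1]) auto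
    show "(\<lambda>w. G (coord s w)) \<in> borel_measurable F"
      using X by simp
    fix A assume "A \<in> sets F"
    then have A: "A \<in> sets (past_sigma path_measure K coord s)" and [measurable]: "A \<in> sets path_measure"
      using F by (auto simp: subalgebra_def)
    have eq: "(LINT w:A|path_measure. f w) = enn2real (\<integral>\<^sup>+w. indicator A w * ennreal (f w) \<partial>path_measure)"
      if [measurable]: "f \<in> borel_measurable path_measure" and "\<And>w. 0 \<le> f w" for f
    proof -
      have "(LINT w:A|path_measure. f w) = enn2real (\<integral>\<^sup>+w. ennreal (indicator A w *\<^sub>R f w) \<partial>path_measure)"
        unfolding set_lebesgue_integral_def using that by (intro integral_eq_nn_integral) auto
      also have "(\<integral>\<^sup>+w. ennreal (indicator A w *\<^sub>R f w) \<partial>path_measure) = (\<integral>\<^sup>+w. indicator A w * ennreal (f w) \<partial>path_measure)"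
        by (intro nn_integral_cong) (auto simp: indicator_def)
      finally show ?thesis .
    qed
    have "(LINT w:A|path_measure. indicator B (coord t w)) = enn2real (\<integral>\<^sup>+w. indicator A w * indicator B (coord t w) \<partial>path_measure)"
      by (subst eq) (auto simp: ennreal_indicator)
    also have "\<dots> = enn2real (\<integral>\<^sup>+w. indicator A w * ennreal (G (coord s w)) \<partial>path_measure)"
      unfolding eG nn_integral_transition_past[OF st B A] ..
    also have "\<dots> = (LINT w:A|path_measure. G (coord s w))"
      using G0 by (subst eq) auto
    finally show "(LINT w:A|path_measure. indicator B (coord t w)) = (LINT w:A|path_measure. G (coord s w))" .
  qed
  then show ?thesis by (simp only: G_def)
qed

lemma markov_process_coord: "markov_process path_measure {0..T} coord"
  unfolding markov_process_def
proof (intro conjI ballI impI)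
  show "prob_space path_measure" by (rule path_space.P.prob_space_axioms)
  show "coord t \<in> borel_measurable path_measure" for t by (rule coord_measurable)
  fix s t :: real and B :: "'a set"
  assume s: "s \<in> {0..T}" and t: "t \<in> {0..T}" and "s \<le> t" and B: "B \<in> sets borel"
  let ?F = "past_sigma path_measure {0..T} coord s"
  let ?P = "vimage_algebra (space path_measure) (coord s) borel"
  have past: "coord s \<in> borel_measurable ?F"
    using coord_measurable_present[of s] present_subset_past[OF s]
    by (auto simp: measurable_def past_sigma_def space_measure_of_conv)
  show "AE w in path_measure. real_cond_exp path_measure ?F (\<lambda>w. indicator B (coord t w)) w
      = real_cond_exp path_measure ?P (\<lambda>w. indicator B (coord t w)) w"
  proof (cases "s < t \<and> t < T")
    case True
    then have st: "0 \<le> s" "s < t" "t < T" using s by auto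
    show ?thesis
      using real_cond_exp_transition[OF st B subalgebra_past_sigma subset_refl past]
        real_cond_exp_transition[OF st B subalgebra_coord present_subset_past[OF s] coord_measurable_present]
      by eventually_elim simp
  next
    case False
    \<comment> \<open>at \<open>t = s\<close> or \<open>t = T\<close> the indicator is already measurable with respect to the present\<close>
    then have "coord t = coord s \<or> coord t = (\<lambda>_. 0)"
      using \<open>s \<le> t\<close> t by (auto simp: coord_def)
    then have m: "(\<lambda>w. indicator B (coord t w) :: real) \<in> borel_measurable F"
      if "coord s \<in> borel_measurable F" for F
      using B that by auto
    have i: "integrable path_measure (\<lambda>w. indicator B (coord t w) :: real)"
      using B by (intro path_space.P.integrable_const_bound[where B=1]) (auto simp: indicator_def)
    interpret F: finite_measure_subalgebra path_measure ?F
      by unfold_locales (rule subalgebra_past_sigma)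
    interpret P: finite_measure_subalgebra path_measure ?P
      by unfold_locales (rule subalgebra_coord)
    show ?thesis
      using F.real_cond_exp_F_meas[OF i m[OF past]] P.real_cond_exp_F_meas[OF i m[OF coord_measurable_present]]
      by eventually_elim simp
  qed
qed

lemma transition_densities_coord: "has_transition_densities path_measure {0..<T} coord p"
  unfolding has_transition_densities_def transition_density_family_def
proof (intro conjI ballI impI allI)
  fix s t :: real and B :: "'a set"
  assume s: "s \<in> {0..<T}" and t: "t \<in> {0..<T}" and "s < t" and B: "B \<in> sets borel"
  then show "AE w in path_measure.
        real_cond_exp path_measure (vimage_algebra (space path_measure) (coord s) borel) (\<lambda>w. indicator B (coord t w)) w
        = (LINT y:B|lborel. p s t (coord s w) y)"
    by (intro real_cond_exp_transition[OF _ _ _ B subalgebra_coord present_subset_past[of s UNIV] coord_measurable_present]) auto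
qed (auto simp: p_measurable p_nonneg p_mass chapman_kolmogorov)

end

section \<open>The matrix exponential and the covariances\<close>

lemma matrix_mult_linear:
  fixes A :: "real ^ 'n ^ 'm"
  shows "(c *\<^sub>R A) ** B = c *\<^sub>R (A ** B)" "A ** (c *\<^sub>R B') = c *\<^sub>R (A ** B')"
    and "(A + A') ** B = A ** B + A' ** B" "A ** (B' + B'') = A ** B' + A ** B''"
  by (simp_all add: vec_eq_iff matrix_matrix_mult_def sum_distrib_left sum.distrib algebra_simps)

text \<open>
With a name for these powers, each entry of the exponential of \<open>t A\<close> is a real power series in \<open>t\<close>, to
which termwise differentiation applies.
\<close>
definition matpow :: "real ^ 'n ^ 'n \<Rightarrow> nat \<Rightarrow> real ^ 'n ^ 'n" where
  "matpow A k = ((**) A ^^ k) (mat 1)"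

lemma matpow_0: "matpow A 0 = mat 1"
  by (simp add: matpow_def)

lemma matpow_Suc: "matpow A (Suc k) = A ** matpow A k"
  by (simp add: matpow_def)

lemma matpow_Suc_right: "matpow A (Suc k) = matpow A k ** A"
proof (induction k)
  case (Suc k)
  then show ?case
    by (metis matpow_Suc matrix_mul_assoc)
qed (simp add: matpow_0 matpow_Suc)

lemma matpow_scaleR: "matpow (t *\<^sub>R A) k = t ^ k *\<^sub>R matpow A k"
  by (induction k) (simp_all add: matpow_0 matpow_Suc matrix_mult_linear mult.commute)

lemma matpow_transpose: "matpow (transpose A) k = transpose (matpow A k)"
  by (induction k) (simp_all add: matpow_0 transpose_mat matpow_Suc[of "transpose A"] matpow_Suc_right[of A] matrix_transpose_mul)

lemma matpow_entry_bound:
  "\<bar>matpow A k $ i $ j\<bar> \<le> (\<Sum>i\<in>UNIV. \<Sum>l\<in>UNIV. \<bar>A $ i $ l\<bar>) ^ k"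
proof (induction k arbitrary: i)
  case 0
  then show ?case by (simp add: matpow_0 mat_def)
next
  case (Suc k)
  let ?c = "\<Sum>i\<in>UNIV. \<Sum>l\<in>UNIV. \<bar>A $ i $ l\<bar>"
  have "\<bar>matpow A (Suc k) $ i $ j\<bar> \<le> (\<Sum>l\<in>UNIV. \<bar>A $ i $ l * matpow A k $ l $ j\<bar>)"
    by (simp add: matpow_Suc matrix_matrix_mult_def sum_abs)
  also have "\<dots> \<le> (\<Sum>l\<in>UNIV. \<bar>A $ i $ l\<bar> * ?c ^ k)"
    using Suc by (intro sum_mono) (simp add: abs_mult mult_left_mono)
  also have "\<dots> = (\<Sum>l\<in>UNIV. \<bar>A $ i $ l\<bar>) * ?c ^ k"
    by (simp add: sum_distrib_right)
  also have "\<dots> \<le> ?c * ?c ^ k"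
    by (intro mult_right_mono member_le_sum zero_le_power) (auto intro: sum_nonneg)
  finally show ?case by simp
qed

lemma summable_matpow_entry: "summable (\<lambda>k. matpow A k $ i $ j / fact k * t ^ k)"
proof (rule summable_comparison_test[OF _ summable_exp])
  let ?c = "\<Sum>i\<in>UNIV. \<Sum>l\<in>UNIV. \<bar>A $ i $ l\<bar>"
  have "norm (matpow A k $ i $ j / fact k * t ^ k) \<le> inverse (fact k) * (?c * \<bar>t\<bar>) ^ k" for k
  proof -
    have "\<bar>matpow A k $ i $ j\<bar> * \<bar>t\<bar> ^ k \<le> ?c ^ k * \<bar>t\<bar> ^ k"
      by (intro mult_right_mono matpow_entry_bound) auto
    then show ?thesis
      by (simp add: abs_mult power_abs power_mult_distrib divide_simps)
  qed
  then show "\<exists>N. \<forall>n\<ge>N. norm (matpow A n $ i $ j / fact n * t ^ n) \<le> inverse (fact n) * (?c * \<bar>t\<bar>) ^ n"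
    by blast
qed

lemma mat_exp_entry: "mat_exp (t *\<^sub>R A) $ i $ j = (\<Sum>k. matpow A k $ i $ j / fact k * t ^ k)"
proof -
  have "(\<lambda>k. (1 / fact k) *\<^sub>R matpow (t *\<^sub>R A) k) sums (\<chi> i j. \<Sum>k. matpow A k $ i $ j / fact k * t ^ k)"
    unfolding sums_def
  proof (intro vec_tendstoI)
    fix i j
    have "(\<lambda>n. \<Sum>k<n. matpow A k $ i $ j / fact k * t ^ k) \<longlonglongrightarrow> (\<Sum>k. matpow A k $ i $ j / fact k * t ^ k)"
      using summable_matpow_entry by (rule summable_LIMSEQ)
    then show "(\<lambda>n. (\<Sum>k<n. (1 / fact k) *\<^sub>R matpow (t *\<^sub>R A) k) $ i $ j)
        \<longlonglongrightarrow> (\<chi> i j. \<Sum>k. matpow A k $ i $ j / fact k * t ^ k) $ i $ j"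
      by (simp add: matpow_scaleR mult_ac)
  qed
  then show ?thesis
    by (simp add: mat_exp_def matpow_def[symmetric] sums_iff)
qed

lemma mat_exp_zero: "mat_exp (0 *\<^sub>R A) = mat 1"
proof -
  have "(\<Sum>k. matpow A k $ i $ j / fact k * 0 ^ k) = mat 1 $ i $ j" for i j
    using powser_zero[of "\<lambda>k. matpow A k $ i $ j / fact k"] by (simp add: matpow_0)
  then show ?thesis
    by (simp only: vec_eq_iff mat_exp_entry) blast
qed

lemma mat_exp_transpose: "mat_exp (t *\<^sub>R transpose A) = transpose (mat_exp (t *\<^sub>R A))"
  by (simp add: vec_eq_iff mat_exp_entry matpow_transpose) (simp add: transpose_def mat_exp_entry)

lemma mat_exp_entry_mult:
  "(A ** mat_exp (t *\<^sub>R A)) $ i $ j = (\<Sum>k. matpow A (Suc k) $ i $ j / fact k * t ^ k)"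
  "(mat_exp (t *\<^sub>R A) ** A) $ i $ j = (\<Sum>k. matpow A (Suc k) $ i $ j / fact k * t ^ k)"
proof -
  have "(A ** mat_exp (t *\<^sub>R A)) $ i $ j = (\<Sum>l\<in>UNIV. \<Sum>k. A $ i $ l * (matpow A k $ l $ j / fact k * t ^ k))"
    by (simp only: matrix_matrix_mult_def vec_lambda_beta mat_exp_entry suminf_mult[OF summable_matpow_entry, symmetric])
  also have "\<dots> = (\<Sum>k. \<Sum>l\<in>UNIV. A $ i $ l * (matpow A k $ l $ j / fact k * t ^ k))"
    by (intro suminf_sum[symmetric] summable_mult summable_matpow_entry)
  finally show "(A ** mat_exp (t *\<^sub>R A)) $ i $ j = (\<Sum>k. matpow A (Suc k) $ i $ j / fact k * t ^ k)"
    by (simp add: matpow_Suc matrix_matrix_mult_def sum_distrib_right sum_divide_distrib mult.assoc)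
  have "(mat_exp (t *\<^sub>R A) ** A) $ i $ j = (\<Sum>l\<in>UNIV. \<Sum>k. (matpow A k $ i $ l / fact k * t ^ k) * A $ l $ j)"
    by (simp only: matrix_matrix_mult_def vec_lambda_beta mat_exp_entry suminf_mult2[OF summable_matpow_entry])
  also have "\<dots> = (\<Sum>k. \<Sum>l\<in>UNIV. (matpow A k $ i $ l / fact k * t ^ k) * A $ l $ j)"
    by (intro suminf_sum[symmetric] summable_mult2 summable_matpow_entry)
  finally show "(mat_exp (t *\<^sub>R A) ** A) $ i $ j = (\<Sum>k. matpow A (Suc k) $ i $ j / fact k * t ^ k)"
    by (simp add: matpow_Suc_right matrix_matrix_mult_def sum_distrib_left sum_distrib_right sum_divide_distrib mult_ac)
qed

lemma mat_exp_commute: "A ** mat_exp (t *\<^sub>R A) = mat_exp (t *\<^sub>R A) ** A"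
  by (simp add: vec_eq_iff mat_exp_entry_mult)

lemma DERIV_mat_exp_entry:
  "((\<lambda>t. mat_exp (t *\<^sub>R A) $ i $ j) has_real_derivative (A ** mat_exp (t *\<^sub>R A)) $ i $ j) (at t)"
proof -
  have "real (Suc k) * (m / fact (Suc k)) = m / fact k" for k and m :: real
    by (simp add: divide_simps del: of_nat_Suc)
  then have "diffs (\<lambda>k. matpow A k $ i $ j / fact k) = (\<lambda>k. matpow A (Suc k) $ i $ j / fact k)"
    by (simp only: diffs_def)
  then show ?thesis
    using termdiffs_strong_converges_everywhere[OF summable_matpow_entry[of A i j], of t]
    by (simp only: mat_exp_entry mat_exp_entry_mult)
qed

lemma continuous_on_mat_exp [continuous_intros]:
  assumes "continuous_on X f"
  shows "continuous_on X (\<lambda>t. mat_exp (f t *\<^sub>R A))"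
proof -
  have "continuous_on UNIV (\<lambda>t. mat_exp (t *\<^sub>R A) $ i $ j)" for i j
    by (intro continuous_at_imp_continuous_on ballI DERIV_isCont[OF DERIV_mat_exp_entry])
  then have "continuous_on UNIV (\<lambda>t. \<chi> i j. mat_exp (t *\<^sub>R A) $ i $ j)"
    by (intro continuous_on_vec_lambda)
  then have "continuous_on UNIV (\<lambda>t. mat_exp (t *\<^sub>R A))"
    by (simp add: vec_lambda_eta)
  from continuous_on_compose2[OF this assms] show ?thesis by simp
qed

text \<open>
The left-hand side is constant in \<open>t\<close>: its derivative vanishes since \<open>A\<close> commutes with its exponential.
\<close>
lemma mat_exp_shift: "mat_exp ((- t) *\<^sub>R A) ** mat_exp ((t + s) *\<^sub>R A) = mat_exp (s *\<^sub>R A)"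
proof -
  define X where "X t = mat_exp ((- t) *\<^sub>R A)" for t
  define Y where "Y t = mat_exp ((t + s) *\<^sub>R A)" for t
  have dX: "((\<lambda>t. X t $ i $ l) has_real_derivative - (X t ** A) $ i $ l) (at t)" for t i l
  proof -
    have "((\<lambda>t. X t $ i $ l) has_real_derivative (A ** X t) $ i $ l * (- 1)) (at t)"
      unfolding X_def by (rule DERIV_chain2[OF DERIV_mat_exp_entry]) (auto intro!: derivative_eq_intros)
    then show ?thesis
      by (simp add: X_def mat_exp_commute[of A "- t", simplified])
  qed
  have dY: "((\<lambda>t. Y t $ l $ j) has_real_derivative (A ** Y t) $ l $ j) (at t)" for t l j
  proof -
    have "((\<lambda>t. Y t $ l $ j) has_real_derivative (A ** Y t) $ l $ j * 1) (at t)"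
      unfolding Y_def by (rule DERIV_chain2[OF DERIV_mat_exp_entry]) (auto intro!: derivative_eq_intros)
    then show ?thesis by simp
  qed
  have "((\<lambda>t. (X t ** Y t) $ i $ j) has_real_derivative 0) (at t)" for t i j
  proof -
    have "((\<lambda>t. \<Sum>l\<in>UNIV. X t $ i $ l * Y t $ l $ j) has_real_derivative
       (\<Sum>l\<in>UNIV. - (X t ** A) $ i $ l * Y t $ l $ j + (A ** Y t) $ l $ j * X t $ i $ l)) (at t)"
      by (intro DERIV_sum DERIV_mult dX dY)
    also have "(\<Sum>l\<in>UNIV. - (X t ** A) $ i $ l * Y t $ l $ j + (A ** Y t) $ l $ j * X t $ i $ l)
       = (X t ** (A ** Y t)) $ i $ j - ((X t ** A) ** Y t) $ i $ j"
      unfolding matrix_matrix_mult_def[of "X t" "A ** Y t"] matrix_matrix_mult_def[of "X t ** A" "Y t"]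
      by (simp add: sum_subtractf mult.commute)
    finally show ?thesis
      by (simp add: matrix_mul_assoc) (simp add: matrix_matrix_mult_def)
  qed
  then have "(X t ** Y t) $ i $ j = (X 0 ** Y 0) $ i $ j" for i j
    by (intro DERIV_isconst_all) auto
  then have "X t ** Y t = X 0 ** Y 0"
    by (simp add: vec_eq_iff)
  then show ?thesis
    by (simp add: X_def Y_def mat_exp_zero[simplified])
qed

lemma mat_exp_minus:
  "mat_exp ((- t) *\<^sub>R A) ** mat_exp (t *\<^sub>R A) = mat 1"
  "mat_exp (t *\<^sub>R A) ** mat_exp ((- t) *\<^sub>R A) = mat 1"
  using mat_exp_shift[of t A 0] mat_exp_shift[of "- t" A 0] by (simp_all add: mat_exp_zero[simplified])

lemma invertible_mat_exp: "invertible (mat_exp (t *\<^sub>R A))"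
  using mat_exp_minus(2) invertible_right_inverse by blast

lemma mat_exp_add: "mat_exp ((t + s) *\<^sub>R A) = mat_exp (t *\<^sub>R A) ** mat_exp (s *\<^sub>R A)"
  by (metis mat_exp_minus(2) mat_exp_shift matrix_mul_assoc matrix_mul_lid)

lemma bounded_linear_matrix_congruence: "bounded_linear (\<lambda>X :: real ^ 'n ^ 'n. E ** X ** F)"
proof -
  have "linear (\<lambda>X :: real ^ 'n ^ 'n. E ** X ** F)"
    by (rule linearI) (simp_all add: matrix_mult_linear)
  then show ?thesis by (simp add: linear_conv_bounded_linear)
qed

lemma pos_definite_integral:
  fixes F :: "real \<Rightarrow> real ^ 'n ^ 'n"
  assumes "0 < t" and F: "continuous_on {0..t} F" "\<And>v. pos_definite (F v)"
  shows "pos_definite (integral {0..t} F)"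
  unfolding pos_definite_def
proof (intro conjI allI impI)
  have int: "F integrable_on {0..t}"
    using F(1) by (rule integrable_continuous_interval)
  have "linear (transpose :: real ^ 'n ^ 'n \<Rightarrow> _)"
    by (rule linearI) (simp_all add: vec_eq_iff transpose_def)
  then have bl: "bounded_linear (transpose :: real ^ 'n ^ 'n \<Rightarrow> _)"
    by (simp add: linear_conv_bounded_linear)
  have "transpose \<circ> F = F"
    using F(2) by (auto simp: pos_definite_def)
  then show "transpose (integral {0..t} F) = integral {0..t} F"
    using integral_linear[OF int bl] by simp
  fix x :: "real ^ 'n" assume "x \<noteq> 0"
  define q where "q X = x \<bullet> (X *v x)" for X :: "real ^ 'n ^ 'n"
  have "linear q"
    unfolding q_def
    by (rule linearI) (simp_all add: matrix_vector_mult_add_rdistrib inner_add_right scaleR_matrix_vector_assoc[symmetric])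
  then have q: "bounded_linear q"
    by (simp add: linear_conv_bounded_linear)
  have qF: "q (F v) > 0" for v
    using F(2)[of v] \<open>x \<noteq> 0\<close> by (simp add: q_def pos_definite_def)
  have cont: "continuous_on {0..t} (\<lambda>v. q (F v))"
    using bounded_linear.continuous_on[OF q F(1)] .
  have "integral {0..t} (\<lambda>v. q (F v)) \<noteq> 0"
  proof
    assume "integral {0..t} (\<lambda>v. q (F v)) = 0"
    then have "\<forall>v\<in>{0..t}. q (F v) = 0"
      using integral_eq_0_iff[OF cont \<open>0 < t\<close>] qF by (simp add: less_imp_le)
    then have "q (F 0) = 0"
      using \<open>0 < t\<close> by simp
    then show False
      using qF[of 0] by simp
  qed
  moreover have "integral {0..t} (\<lambda>v. q (F v)) \<ge> 0"
    using qF by (intro integral_nonneg integrable_continuous_interval cont) (auto intro: less_imp_le)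
  moreover have "integral {0..t} (\<lambda>v. q (F v)) = q (integral {0..t} F)"
    using integral_linear[OF int q] by (simp add: o_def)
  ultimately show "0 < x \<bullet> (integral {0..t} F *v x)"
    by (simp add: q_def)
qed

text \<open>
The covariance of an infinitesimal noise increment after it has been transported by the linear flow for
a time \<open>v\<close>.
\<close>
definition flow_cov :: "real ^ 'd ^ 'd \<Rightarrow> real ^ 'r ^ 'd \<Rightarrow> real \<Rightarrow> real ^ 'd ^ 'd" where
  "flow_cov A S v = mat_exp (v *\<^sub>R A) ** (S ** transpose S) ** transpose (mat_exp (v *\<^sub>R A))"

lemma ou_cov_flow: "ou_cov A S t = integral {0..t} (\<lambda>v. flow_cov A S (t - v))"
  by (simp add: ou_cov_def flow_cov_def mat_exp_transpose)

lemma ou_cov_tilde_flow: "ou_cov_tilde A S t = integral {0..t} (\<lambda>v. flow_cov A S (- v))"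
  unfolding ou_cov_tilde_def flow_cov_def mat_exp_transpose ..

lemma flow_cov_add:
  "flow_cov A S (t + v) = mat_exp (t *\<^sub>R A) ** flow_cov A S v ** transpose (mat_exp (t *\<^sub>R A))"
  by (simp add: flow_cov_def mat_exp_add matrix_transpose_mul matrix_mul_assoc)

lemma pos_definite_flow_cov:
  "pos_definite (S ** transpose S) \<Longrightarrow> pos_definite (flow_cov A S v)"
  unfolding flow_cov_def by (intro pos_definite_congruence invertible_mat_exp)

lemma continuous_on_matrix_mult [continuous_intros]:
  fixes f :: "'a::topological_space \<Rightarrow> real ^ 'n ^ 'm" and g :: "'a \<Rightarrow> real ^ 'k ^ 'n"
  assumes "continuous_on X f" "continuous_on X g"
  shows "continuous_on X (\<lambda>x. f x ** g x)"
  unfolding matrix_matrix_mult_def by (intro continuous_intros assms)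

lemma continuous_on_flow_cov [continuous_intros]:
  assumes "continuous_on X f"
  shows "continuous_on X (\<lambda>v. flow_cov A S (f v))"
  unfolding flow_cov_def mat_exp_transpose[symmetric] by (intro continuous_intros assms)

lemma pos_definite_ou_cov:
  "pos_definite (S ** transpose S) \<Longrightarrow> 0 < t \<Longrightarrow> pos_definite (ou_cov A S t)"
  unfolding ou_cov_flow by (intro pos_definite_integral pos_definite_flow_cov continuous_intros)

lemma pos_definite_ou_cov_tilde:
  "pos_definite (S ** transpose S) \<Longrightarrow> 0 < t \<Longrightarrow> pos_definite (ou_cov_tilde A S t)"
  unfolding ou_cov_tilde_flow by (intro pos_definite_integral pos_definite_flow_cov continuous_intros)

lemma integral_flow_congruence:
  fixes f :: "real \<Rightarrow> real"
  assumes "continuous_on {0..t} f"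
  shows "integral {0..t} (\<lambda>v. flow_cov A S (s + f v))
       = mat_exp (s *\<^sub>R A) ** integral {0..t} (\<lambda>v. flow_cov A S (f v)) ** transpose (mat_exp (s *\<^sub>R A))"
proof -
  have "(\<lambda>v. flow_cov A S (f v)) integrable_on {0..t}"
    by (intro integrable_continuous_interval continuous_on_flow_cov assms)
  from integral_linear[OF this bounded_linear_matrix_congruence] show ?thesis
    by (simp add: o_def flow_cov_add)
qed

lemma ou_cov_eq_tilde:
  "ou_cov A S t = mat_exp (t *\<^sub>R A) ** ou_cov_tilde A S t ** transpose (mat_exp (t *\<^sub>R A))"
  unfolding ou_cov_flow ou_cov_tilde_flow
  using integral_flow_congruence[of t "\<lambda>v. - v" A S t] by (simp add: continuous_intros)

text \<open>
The noise collected up to time \<open>s\<close> is transported by the flow for a further time \<open>t\<close>; the noise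
collected afterwards is added independently.
\<close>
lemma ou_cov_add:
  assumes "0 \<le> s" "0 \<le> t"
  shows "ou_cov A S (s + t) = ou_cov A S t + mat_exp (t *\<^sub>R A) ** ou_cov A S s ** transpose (mat_exp (t *\<^sub>R A))"
proof -
  let ?f = "\<lambda>v. flow_cov A S (s + t - v)"
  have int: "?f integrable_on {0..s + t}"
    by (intro integrable_continuous_interval continuous_intros)
  have "(?f has_integral integral {s..s + t} ?f) (cbox s (s + t))"
    using integrable_integral[OF integrable_on_subinterval[OF int]] assms by simp
  then have "((?f \<circ> (+) s) has_integral integral {s..s + t} ?f) {0..t}"
    by (subst has_integral_shift_Icc_real) (simp add: add.commute)
  then have "ou_cov A S t = integral {s..s + t} ?f"
    unfolding ou_cov_flow by (simp add: o_def integral_unique)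
  moreover have "integral {0..s} ?f = mat_exp (t *\<^sub>R A) ** ou_cov A S s ** transpose (mat_exp (t *\<^sub>R A))"
    unfolding ou_cov_flow
    using integral_flow_congruence[of s "\<lambda>v. s - v" A S t] by (simp add: continuous_intros algebra_simps)
  moreover have "integral {0..s} ?f + integral {s..s + t} ?f = integral {0..s + t} ?f"
    using assms by (intro Henstock_Kurzweil_Integration.integral_combine int) auto
  ultimately show ?thesis
    by (simp add: ou_cov_flow[of A S "s + t"] add.commute)
qed

section \<open>The bridge\<close>

lemma ball_average_tendsto:
  fixes q :: "'a::euclidean_space \<Rightarrow> real"
  assumes q: "continuous_on UNIV q"
  shows "((\<lambda>\<epsilon>. (LINT z:ball 0 \<epsilon>|lborel. q z) / measure lborel (ball 0 \<epsilon> :: 'a set)) \<longlongrightarrow> q 0) (at_right 0)"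
proof (rule tendstoI)
  fix e :: real assume "0 < e"
  then obtain d where d: "0 < d" "\<And>z. dist z 0 < d \<Longrightarrow> dist (q z) (q 0) < e / 2"
    using q unfolding continuous_on_iff by (metis UNIV_I half_gt_zero)
  show "\<forall>\<^sub>F \<epsilon> in at_right 0. dist ((LINT z:ball 0 \<epsilon>|lborel. q z) / measure lborel (ball 0 \<epsilon> :: 'a set)) (q 0) < e"
    unfolding eventually_at_right_field
  proof (intro exI[of _ d] conjI allI impI)
    fix \<epsilon> :: real assume "0 < \<epsilon>" "\<epsilon> < d"
    let ?B = "ball 0 \<epsilon> :: 'a set"
    let ?\<mu> = "measure lborel ?B"
    have \<mu>: "?\<mu> > 0"
      using content_ball_pos[OF \<open>0 < \<epsilon>\<close>] by simp
    have int: "set_integrable lborel ?B f" if "continuous_on UNIV f" for f :: "'a \<Rightarrow> real"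
    proof (rule set_integrable_subset)
      show "set_integrable lborel (cball 0 \<epsilon>) f"
        unfolding set_integrable_def
        by (intro borel_integrable_compact continuous_on_subset[OF that]) simp_all
    qed simp_all
    have const: "(LINT z:?B|lborel. c) = ?\<mu> * c" for c :: real
      unfolding set_lebesgue_integral_def by simp
    have "(LINT z:?B|lborel. q z) - ?\<mu> * q 0 = (LINT z:?B|lborel. q z - q 0)"
      by (subst set_integral_diff(2)) (auto intro: int q simp: const)
    also have "norm \<dots> \<le> (LINT z:?B|lborel. norm (q z - q 0))"
      by (intro set_integral_norm_bound int continuous_intros q)
    also have "\<dots> \<le> (LINT z:?B|lborel. e / 2)"
    proof (intro set_integral_mono int continuous_intros q)
      fix z assume "z \<in> ?B"
      then have "dist (q z) (q 0) < e / 2"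
        using \<open>\<epsilon> < d\<close> by (intro d(2)) (simp add: dist_commute)
      then show "norm (q z - q 0) \<le> e / 2"
        by (simp add: dist_norm)
    qed
    also have "\<dots> = ?\<mu> * (e / 2)" by (rule const)
    finally have "\<bar>(LINT z:?B|lborel. q z) - ?\<mu> * q 0\<bar> \<le> ?\<mu> * (e / 2)" by simp
    also have "\<dots> < ?\<mu> * e" using \<mu> \<open>0 < e\<close> by simp
    finally have "\<bar>(LINT z:?B|lborel. q z) - ?\<mu> * q 0\<bar> < ?\<mu> * e" .
    moreover have "(LINT z:?B|lborel. q z) / ?\<mu> - q 0 = ((LINT z:?B|lborel. q z) - ?\<mu> * q 0) / ?\<mu>"
      using \<mu> by (simp add: field_simps)
    ultimately show "dist ((LINT z:?B|lborel. q z) / ?\<mu>) (q 0) < e"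
      using \<mu> by (simp add: dist_real_def divide_simps mult.commute)
  qed (rule d)
qed

lemma ball_ratio_tendsto:
  fixes q r :: "'a::euclidean_space \<Rightarrow> real"
  assumes "continuous_on UNIV q" "continuous_on UNIV r" "r 0 \<noteq> 0"
  shows "((\<lambda>\<epsilon>. (LINT z:ball 0 \<epsilon>|lborel. q z) / (LINT z:ball 0 \<epsilon>|lborel. r z)) \<longlongrightarrow> q 0 / r 0) (at_right 0)"
proof (rule Lim_transform_eventually)
  let ?\<mu> = "\<lambda>\<epsilon>. measure lborel (ball 0 \<epsilon> :: 'a set)"
  show "((\<lambda>\<epsilon>. ((LINT z:ball 0 \<epsilon>|lborel. q z) / ?\<mu> \<epsilon>) / ((LINT z:ball 0 \<epsilon>|lborel. r z) / ?\<mu> \<epsilon>)) \<longlongrightarrow> q 0 / r 0) (at_right 0)"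
    by (intro tendsto_divide ball_average_tendsto assms)
  show "\<forall>\<^sub>F \<epsilon> in at_right 0. ((LINT z:ball 0 \<epsilon>|lborel. q z) / ?\<mu> \<epsilon>) / ((LINT z:ball 0 \<epsilon>|lborel. r z) / ?\<mu> \<epsilon>)
      = (LINT z:ball 0 \<epsilon>|lborel. q z) / (LINT z:ball 0 \<epsilon>|lborel. r z)"
    using eventually_at_right_less[of "0::real"]
  proof eventually_elim
    case (elim \<epsilon>)
    then have "?\<mu> \<epsilon> > 0"
      using content_ball_pos[of \<epsilon> "0::'a"] by simp
    then show ?case by simp
  qed
qed

lemma ou_density_gauss: "ou_density A S t x y = gauss_density (ou_cov A S t) (y - mat_exp (t *\<^sub>R A) *v x)"
  by (simp add: ou_density_def gauss_density_def)

text \<open>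
The densities are continuous and positive, so the balls shrinking to \<open>0\<close> leave the quotient of the values
at \<open>0\<close>: the result is Doob's transform by \<open>y \<mapsto> ou_density A S (T - t) y 0\<close>.
\<close>
lemma bridge_density_eq:
  assumes S: "pos_definite (S ** transpose S)" and st: "s < t" "t < T"
  shows "bridge_density (ou_density A S) T s t x y
       = ou_density A S (t - s) x y * ou_density A S (T - t) y 0 / ou_density A S (T - s) x 0"
proof -
  let ?R = "\<lambda>\<epsilon>. (LINT z:ball 0 \<epsilon>|lborel. ou_density A S (T - t) y z) / (LINT z:ball 0 \<epsilon>|lborel. ou_density A S (T - s) x z)"
  have "pos_definite (ou_cov A S (T - s))"
    using S st by (intro pos_definite_ou_cov) auto
  then have "ou_density A S (T - s) x 0 \<noteq> 0"
    using gauss_density_pos[of "ou_cov A S (T - s)"] by (metis ou_density_gauss less_irrefl)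
  then have lim: "(?R \<longlongrightarrow> ou_density A S (T - t) y 0 / ou_density A S (T - s) x 0) (at_right 0)"
    by (intro ball_ratio_tendsto) (simp_all add: ou_density_gauss continuous_intros)
  then have "Lim (at_right 0) ?R = ou_density A S (T - t) y 0 / ou_density A S (T - s) x 0"
    by (intro tendsto_Lim) simp_all
  with lim show ?thesis
    unfolding bridge_density_def Let_def by auto
qed

lemma ou_density_pos:
  "pos_definite (S ** transpose S) \<Longrightarrow> 0 < t \<Longrightarrow> ou_density A S t x y > 0"
  by (simp add: ou_density_gauss gauss_density_pos pos_definite_ou_cov)

lemma ou_density_chapman_kolmogorov:
  assumes S: "pos_definite (S ** transpose S)" and "0 < s" "0 < t"
  shows "(\<integral>\<^sup>+y. ennreal (ou_density A S s x y * ou_density A S t y z) \<partial>lborel) = ennreal (ou_density A S (s + t) x z)"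
proof -
  have W: "ou_cov A S (s + t) = ou_cov A S t + mat_exp (t *\<^sub>R A) ** ou_cov A S s ** transpose (mat_exp (t *\<^sub>R A))"
    using assms by (intro ou_cov_add) auto
  have E: "mat_exp (t *\<^sub>R A) *v (mat_exp (s *\<^sub>R A) *v x) = mat_exp ((s + t) *\<^sub>R A) *v x"
    by (simp only: matrix_vector_mul_assoc mat_exp_add[symmetric] add.commute)
  have "pos_definite (ou_cov A S t + mat_exp (t *\<^sub>R A) ** ou_cov A S s ** transpose (mat_exp (t *\<^sub>R A)))"
    unfolding W[symmetric] using assms by (intro pos_definite_ou_cov) auto
  from gauss_density_convolution[OF pos_definite_ou_cov[OF S \<open>0 < s\<close>] pos_definite_ou_cov[OF S \<open>0 < t\<close>] this]
  show ?thesis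
    by (simp only: ou_density_gauss W E)
qed

text \<open>
In a product of two consecutive bridge densities the factors belonging to the intermediate time cancel,
which reduces the Chapman-Kolmogorov equation to that of the process itself.  The total mass is one by
the same equation with the endpoint \<open>0\<close> at time \<open>T\<close>.
\<close>
lemma markov_densities_bridge:
  assumes S: "pos_definite (S ** transpose S)"
  shows "markov_densities T (bridge_density (ou_density A S) T)"
proof
  note pos = ou_density_pos[OF S] and ck = ou_density_chapman_kolmogorov[OF S]
  note eq = bridge_density_eq[OF S]
  fix s t :: real assume s: "0 \<le> s" and st: "s < t" and t: "t < T"
  have "(\<lambda>(x, y). ou_density A S (t - s) x y * ou_density A S (T - t) y 0 / ou_density A S (T - s) x 0)
      \<in> borel_measurable (borel \<Otimes>\<^sub>M borel)"
    unfolding ou_density_gauss by measurable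
  then show "(\<lambda>(x, y). bridge_density (ou_density A S) T s t x y) \<in> borel_measurable (borel \<Otimes>\<^sub>M borel)"
    by (simp only: eq[OF st t])
  show "0 \<le> bridge_density (ou_density A S) T s t x y" for x y
    using pos[of "t - s" A x y] pos[of "T - t" A y 0] pos[of "T - s" A x 0] st t
    by (simp add: eq[OF st t])
  show "(\<integral>\<^sup>+y. ennreal (bridge_density (ou_density A S) T s t x y) \<partial>lborel) = 1" for x
  proof -
    define h where "h = ou_density A S (T - s) x 0"
    have h: "0 < h" using pos st t by (simp add: h_def)
    have "(\<integral>\<^sup>+y. ennreal (bridge_density (ou_density A S) T s t x y) \<partial>lborel)
        = (\<integral>\<^sup>+y. ennreal (1 / h) * ennreal (ou_density A S (t - s) x y * ou_density A S (T - t) y 0) \<partial>lborel)"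
      using h by (intro nn_integral_cong) (simp add: eq[OF st t] h_def ennreal_mult'[symmetric])
    also have "\<dots> = ennreal (1 / h) * (\<integral>\<^sup>+y. ennreal (ou_density A S (t - s) x y * ou_density A S (T - t) y 0) \<partial>lborel)"
      unfolding ou_density_gauss by (intro nn_integral_cmult) measurable
    also have "\<dots> = ennreal (1 / h) * ennreal h"
      using st t by (subst ck) (auto simp: h_def)
    also have "\<dots> = 1"
      using h by (simp add: ennreal_mult'[symmetric])
    finally show ?thesis .
  qed
next
  note pos = ou_density_pos[OF S] and ck = ou_density_chapman_kolmogorov[OF S]
  note eq = bridge_density_eq[OF S]
  fix s t u :: real and x z assume s: "0 \<le> s" and st: "s < t" and tu: "t < u" and u: "u < T"
  have t: "t < T" using tu u by simp
  define c where "c = ou_density A S (T - u) z 0 / ou_density A S (T - s) x 0"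
  have c: "0 \<le> c"
    using pos[of "T - u" A z 0] pos[of "T - s" A x 0] st t u by (simp add: c_def)
  have su: "s < u" using st tu by simp
  have "(\<integral>\<^sup>+y. ennreal (bridge_density (ou_density A S) T s t x y * bridge_density (ou_density A S) T t u y z) \<partial>lborel)
      = (\<integral>\<^sup>+y. ennreal c * ennreal (ou_density A S (t - s) x y * ou_density A S (u - t) y z) \<partial>lborel)"
  proof (intro nn_integral_cong)
    fix y
    have "ou_density A S (T - t) y 0 \<noteq> 0"
      using pos[of "T - t" A y 0] t by simp
    then have "bridge_density (ou_density A S) T s t x y * bridge_density (ou_density A S) T t u y z
        = c * (ou_density A S (t - s) x y * ou_density A S (u - t) y z)"
      by (simp add: eq[OF st t] eq[OF tu u] c_def)
    then show "ennreal (bridge_density (ou_density A S) T s t x y * bridge_density (ou_density A S) T t u y z)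
        = ennreal c * ennreal (ou_density A S (t - s) x y * ou_density A S (u - t) y z)"
      using c by (simp only: ennreal_mult')
  qed
  also have "\<dots> = ennreal c * (\<integral>\<^sup>+y. ennreal (ou_density A S (t - s) x y * ou_density A S (u - t) y z) \<partial>lborel)"
    unfolding ou_density_gauss by (intro nn_integral_cmult) measurable
  also have "\<dots> = ennreal c * ennreal (ou_density A S (u - s) x z)"
    using st tu by (subst ck) auto
  also have "\<dots> = ennreal (bridge_density (ou_density A S) T s u x z)"
    by (simp only: ennreal_mult'[OF c, symmetric]) (simp add: eq[OF su u] c_def mult.commute)
  finally show "ennreal (bridge_density (ou_density A S) T s u x z)
      = (\<integral>\<^sup>+y. ennreal (bridge_density (ou_density A S) T s t x y * bridge_density (ou_density A S) T t u y z) \<partial>lborel)" ..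
qed

lemma zero_bridge_exists:
  fixes A :: "real ^ 'd ^ 'd" and S :: "real ^ 'r ^ 'd"
  assumes "pos_definite (S ** transpose S)"
  shows "\<exists>(N :: (real \<Rightarrow> real ^ 'd) measure) X. zero_bridge (ou_density A S) T N X"
proof -
  interpret markov_densities T "bridge_density (ou_density A S) T"
    by (rule markov_densities_bridge[OF assms])
  have "zero_bridge (ou_density A S) T path_measure coord"
    unfolding zero_bridge_def
    using markov_process_coord transition_densities_coord by (simp add: coord_def)
  then show ?thesis by blast
qed

lemma quadratic_form_congruence:
  fixes E V :: "real ^ 'n ^ 'n"
  assumes E: "invertible E" and V: "pos_definite V"
  shows "(E *v u) \<bullet> (matrix_inv (E ** V ** transpose E) *v (E *v u)) = u \<bullet> (matrix_inv V *v u)"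
proof -
  let ?W = "E ** V ** transpose E"
  define w where "w = matrix_inv ?W *v (E *v u)"
  have "?W *v w = E *v u"
    unfolding w_def by (intro matrix_inv_mult_vec pos_definite_invertible pos_definite_congruence E V)
  then have "E *v (V *v (transpose E *v w)) = E *v u"
    by (simp only: matrix_vector_mul_assoc[symmetric])
  then have "V *v (transpose E *v w) = u"
    by (metis matrix_inv_mult_vec(2)[OF E])
  then have "transpose E *v w = matrix_inv V *v u"
    using matrix_inv_mult_vec(2)[OF pos_definite_invertible[OF V]] by metis
  then show ?thesis
    unfolding w_def[symmetric] by (metis inner_matrix_vector_swap transpose_transpose)
qed

text \<open>
The density with the starting point in the role of the variable: the displacement \<open>y - E x\<close> is the image
of \<open>E\<^sup>-\<^sup>1 y - x\<close> under the flow \<open>E\<close>, which turns the covariance into that of the reversed flow.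
\<close>
lemma ou_density_tilde:
  fixes A :: "real ^ 'd ^ 'd" and S :: "real ^ 'r ^ 'd"
  assumes S: "pos_definite (S ** transpose S)" and t: "0 < t"
  shows "ou_density A S t x y
       = 1 / sqrt ((2 * pi) ^ CARD('d) * ((det (mat_exp (t *\<^sub>R A)))\<^sup>2 * det (ou_cov_tilde A S t))) *
         exp (- (1 / 2) * ((x - mat_exp ((- t) *\<^sub>R A) *v y) \<bullet>
           (matrix_inv (ou_cov_tilde A S t) *v (x - mat_exp ((- t) *\<^sub>R A) *v y))))"
proof -
  define u where "u = x - mat_exp ((- t) *\<^sub>R A) *v y"
  have "y - mat_exp (t *\<^sub>R A) *v x = mat_exp (t *\<^sub>R A) *v (- u)"
  proof -
    have "mat_exp (t *\<^sub>R A) *v (mat_exp ((- t) *\<^sub>R A) *v y) = y"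
      by (simp only: matrix_vector_mul_assoc mat_exp_minus matrix_vector_mul_lid)
    then show ?thesis
      by (simp add: u_def matrix_vector_mult_diff_distrib)
  qed
  moreover have "(mat_exp (t *\<^sub>R A) *v (- u)) \<bullet> (matrix_inv (ou_cov A S t) *v (mat_exp (t *\<^sub>R A) *v (- u)))
      = (- u) \<bullet> (matrix_inv (ou_cov_tilde A S t) *v (- u))"
    unfolding ou_cov_eq_tilde[of A S t]
    by (intro quadratic_form_congruence invertible_mat_exp pos_definite_ou_cov_tilde S t)
  moreover have "(- u) \<bullet> (matrix_inv (ou_cov_tilde A S t) *v (- u)) = u \<bullet> (matrix_inv (ou_cov_tilde A S t) *v u)"
    using matrix_vector_mult_diff_distrib[of "matrix_inv (ou_cov_tilde A S t)" 0 u] by simp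
  moreover have "det (ou_cov A S t) = (det (mat_exp (t *\<^sub>R A)))\<^sup>2 * det (ou_cov_tilde A S t)"
    by (simp add: ou_cov_eq_tilde[of A S t] det_mul power2_eq_square mult_ac)
  ultimately show ?thesis
    unfolding ou_density_def u_def[symmetric] by (simp only:)
qed

lemma bridge_density_tilde:
  fixes A :: "real ^ 'd ^ 'd" and \<Sigma> :: "real ^ 'r ^ 'd"
  assumes S: "pos_definite (\<Sigma> ** transpose \<Sigma>)" and st: "s < t" "t < T"
  shows "bridge_density (ou_density A \<Sigma>) T s t x y =
        sqrt (det (ou_cov_tilde A \<Sigma> (T - s)) /
              ((2 * pi) ^ CARD('d) * det (ou_cov_tilde A \<Sigma> (t - s) ** ou_cov_tilde A \<Sigma> (T - t)))) *
        exp (- (1 / 2) * ((x - mat_exp (- (t - s) *\<^sub>R A) *v y) \<bullet>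
                (matrix_inv (ou_cov_tilde A \<Sigma> (t - s)) *v (x - mat_exp (- (t - s) *\<^sub>R A) *v y)))
             - (1 / 2) * (y \<bullet> (matrix_inv (ou_cov_tilde A \<Sigma> (T - t)) *v y))
             + (1 / 2) * (x \<bullet> (matrix_inv (ou_cov_tilde A \<Sigma> (T - s)) *v x)))"
proof -
  define K where "K = (2 * pi) ^ CARD('d)"
  define e where "e r = det (mat_exp (r *\<^sub>R A))" for r
  define D where "D r = det (ou_cov_tilde A \<Sigma> r)" for r
  define Q where "Q r v = v \<bullet> (matrix_inv (ou_cov_tilde A \<Sigma> r) *v v)" for r v
  have pos: "0 < t - s" "0 < T - t" "0 < T - s" using st by auto
  have K: "K > 0" by (simp add: K_def)
  have D: "D r > 0" if "0 < r" for r
    using pos_definite_det_pos[OF pos_definite_ou_cov_tilde[OF S that]] by (simp add: D_def)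
  have "mat_exp ((T - s) *\<^sub>R A) = mat_exp ((t - s) *\<^sub>R A) ** mat_exp ((T - t) *\<^sub>R A)"
    using mat_exp_add[of "t - s" "T - t" A] by simp
  then have e: "e (T - s) = e (t - s) * e (T - t)"
    by (simp add: e_def det_mul)
  have e0: "e r \<noteq> 0" for r
    using invertible_mat_exp[of r A] by (simp add: e_def invertible_det_nz)
  have dens: "ou_density A \<Sigma> r x y = 1 / sqrt (K * ((e r)\<^sup>2 * D r)) * exp (- (1 / 2) * Q r (x - mat_exp ((- r) *\<^sub>R A) *v y))"
    if "0 < r" for r x y
    unfolding ou_density_tilde[OF S that] K_def e_def D_def Q_def ..
  have dens0: "ou_density A \<Sigma> r x 0 = 1 / sqrt (K * ((e r)\<^sup>2 * D r)) * exp (- (1 / 2) * Q r x)"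
    if "0 < r" for r x
    using dens[OF that, of x 0] by simp
  have const: "1 / sqrt (K * ((e (t - s))\<^sup>2 * D (t - s))) * (1 / sqrt (K * ((e (T - t))\<^sup>2 * D (T - t))))
      / (1 / sqrt (K * ((e (T - s))\<^sup>2 * D (T - s)))) = sqrt (D (T - s) / (K * (D (t - s) * D (T - t))))"
  proof -
    have "1 / sqrt (K * ((e (t - s))\<^sup>2 * D (t - s))) * (1 / sqrt (K * ((e (T - t))\<^sup>2 * D (T - t))))
      / (1 / sqrt (K * ((e (T - s))\<^sup>2 * D (T - s))))
      = sqrt ((K * ((e (T - s))\<^sup>2 * D (T - s))) / ((K * ((e (t - s))\<^sup>2 * D (t - s))) * (K * ((e (T - t))\<^sup>2 * D (T - t)))))"
      by (simp add: real_sqrt_divide real_sqrt_mult)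
    also have "(K * ((e (T - s))\<^sup>2 * D (T - s))) / ((K * ((e (t - s))\<^sup>2 * D (t - s))) * (K * ((e (T - t))\<^sup>2 * D (T - t))))
      = D (T - s) / (K * (D (t - s) * D (T - t)))"
      using K e0[of "t - s"] e0[of "T - t"] by (simp add: e power_mult_distrib)
    finally show ?thesis .
  qed
  define x' where "x' = x - mat_exp ((- (t - s)) *\<^sub>R A) *v y"
  have "bridge_density (ou_density A \<Sigma>) T s t x y
      = (1 / sqrt (K * ((e (t - s))\<^sup>2 * D (t - s))) * exp (- (1 / 2) * Q (t - s) x'))
        * (1 / sqrt (K * ((e (T - t))\<^sup>2 * D (T - t))) * exp (- (1 / 2) * Q (T - t) y))
        / (1 / sqrt (K * ((e (T - s))\<^sup>2 * D (T - s))) * exp (- (1 / 2) * Q (T - s) x))"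
    unfolding bridge_density_eq[OF S st] dens[OF pos(1)] dens0[OF pos(2)] dens0[OF pos(3)] x'_def ..
  also have "\<dots> = sqrt (D (T - s) / (K * (D (t - s) * D (T - t)))) *
      (exp (- (1 / 2) * Q (t - s) x') * exp (- (1 / 2) * Q (T - t) y) / exp (- (1 / 2) * Q (T - s) x))"
    unfolding const[symmetric] by simp
  also have "exp (- (1 / 2) * Q (t - s) x') * exp (- (1 / 2) * Q (T - t) y) / exp (- (1 / 2) * Q (T - s) x)
      = exp (- (1 / 2) * Q (t - s) x' - (1 / 2) * Q (T - t) y + (1 / 2) * Q (T - s) x)"
    by (simp add: exp_add[symmetric] exp_diff[symmetric])
  finally show ?thesis
    unfolding K_def D_def Q_def x'_def det_mul .
qed

theorem mainTheorem5:
  fixes A :: "real ^ 'd ^ 'd"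
    and \<Sigma> :: "real ^ 'r ^ 'd"
    and T :: real
    and M :: "'w measure"
    and W :: "real \<Rightarrow> 'w \<Rightarrow> real ^ 'r"
    and Z :: "real \<Rightarrow> 'w \<Rightarrow> real ^ 'd"
  assumes "pos_definite (\<Sigma> ** transpose \<Sigma>)"
    and "wiener_process M W"
    and "T > 0"
    and "ou_process A \<Sigma> M W Z"
  shows "(\<exists>(N :: (real \<Rightarrow> real ^ 'd) measure) X. zero_bridge (ou_density A \<Sigma>) T N X) \<and>
    (\<forall>s t x y. 0 \<le> s \<longrightarrow> s < t \<longrightarrow> t < T \<longrightarrow>
      bridge_density (ou_density A \<Sigma>) T s t x y =
        sqrt (det (ou_cov_tilde A \<Sigma> (T - s)) /
              ((2 * pi) ^ CARD('d) * det (ou_cov_tilde A \<Sigma> (t - s) ** ou_cov_tilde A \<Sigma> (T - t)))) *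
        exp (- (1 / 2) * ((x - mat_exp (- (t - s) *\<^sub>R A) *v y) \<bullet>
                (matrix_inv (ou_cov_tilde A \<Sigma> (t - s)) *v (x - mat_exp (- (t - s) *\<^sub>R A) *v y)))
             - (1 / 2) * (y \<bullet> (matrix_inv (ou_cov_tilde A \<Sigma> (T - t)) *v y))
             + (1 / 2) * (x \<bullet> (matrix_inv (ou_cov_tilde A \<Sigma> (T - s)) *v x))))"
  using zero_bridge_exists[OF assms(1)] bridge_density_tilde[OF assms(1)] by (intro conjI allI impI)

end
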